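(* Let $M:[0,\infty)\to[0,\infty)$ be a differentiable $N$-function and let $D_M\ge d_M\ge 1$ be constants with $d_M\frac{M(\lambda)}{\lambda}\le M'(\lambda)\le D_M\frac{M(\lambda)}{\lambda}$ for every $\lambda>0$. Let $\varphi\in C^2(\mathbb{R}_+)$ be such that $\varphi'$ never vanishes, let $\mu(dr)=e^{-\varphi(r)}dr$ on $\mathbb{R}_+$, and let $\omega:(0,\infty)\to[0,\infty)$ be a $C^1$ function. Suppose that $L=L(\omega,\varphi)<\infty$ and put $c(x)=\max(x^{d_M},x^{D_M})$. (1) If $b_1=b_1(\omega,\varphi,M)>0$, then $$\int_{\mathbb{R}_+}M(\omega(r)|u(r)|)\,\mu(dr)\le C\int_{\mathbb{R}_+}M(|u'(r)|)\,\mu(dr)$$ holds for every $u\in\mathcal{R}^+_{(\omega,\varphi,M)}$, with $C=c\left(\frac{LD_M^2}{b_1d_M}\right)$. (2) If $b_2=b_2(\omega,\varphi,M)>0$, then the same inequality holds for every $u\in\mathcal{R}^-_{(\omega,\varphi,M)}$, with $C=c\left(\frac{LD_M^2}{b_2d_M}\right)$.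
   Context: $\mathbb{R}_+=(0,\infty)$. Functions in $W^{1,1}_{loc}(\mathbb{R}_+)$ are identified with their locally absolutely continuous representatives. An $N$-function is a continuous convex function $M:[0,\infty)\to[0,\infty)$ with $M(\lambda)/\lambda\to0$ as $\lambda\to0$ and $M(\lambda)/\lambda\to\infty$ as $\lambda\to\infty$. Let $F=\{r\in\mathbb{R}_+:\omega(r)\ne0,\ \omega'(r)\varphi'(r)>0\}$ and $G=\{r\in\mathbb{R}_+:\omega(r)\neq0,\ \omega'(r)\varphi'(r)<0\}$, with $\chi_A$ the indicator function of $A$ (an expression $f\chi_A$ is taken to be $0$ outside $A$). Define $$b_1(r,\omega,\varphi,M)=1+\frac{\varphi''(r)}{(\varphi'(r))^2}-\frac{\omega'(r)}{\omega(r)\varphi'(r)}\left[d_M\chi_G(r)+D_M\chi_F(r)\right],\quad b_1=\inf_{r>0}b_1(r,\omega,\varphi,M),$$ $$b_2(r,\omega,\varphi,M)=-1-\frac{\varphi''(r)}{(\varphi'(r))^2}+\frac{\omega'(r)}{\omega(r)\varphi'(r)}\left[d_M\chi_F(r)+D_M\chi_G(r)\right],\quad b_2=\inf_{r>0}b_2(r,\omega,\varphi,M),$$ $$L=L(\omega,\varphi)=\sup_{r>0}\frac{\omega(r)}{|\varphi'(r)|}.$$ For $u\in W^{1,1}_{loc}(\mathbb{R}_+)$ set $h^u(r)=\frac{1}{\varphi'(r)}M(\omega(r)|u(r)|)$. Then $\mathcal{R}^+_{(\omega,\varphi,M)}$ (respectively $\mathcal{R}^-_{(\omega,\varphi,M)}$)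 is the set of $u\in W^{1,1}_{loc}(\mathbb{R}_+)$ for which there exist sequences $s_n\to0$, $R_n\to\infty$ such that $\lim_{n\to\infty}\left(h^u(R_n)e^{-\varphi(R_n)}-h^u(s_n)e^{-\varphi(s_n)}\right)$ exists in $[-\infty,\infty]$ and is $\ge0$ (respectively $\le0$). *)

theory Defs
  imports "HOL-Analysis.Analysis"
begin

text \<open>
  The half-line \<open>(0, \<infinity>)\<close> is \<open>{0<..} :: real set\<close>. Functions on it are total functions
  \<open>real \<Rightarrow> real\<close> whose values outside \<open>{0<..}\<close> are irrelevant.
\<close>

definition N_function :: "(real \<Rightarrow> real) \<Rightarrow> bool" where
  "N_function M \<longleftrightarrow>
     (\<forall>x\<ge>0. 0 \<le> M x) \<and> continuous_on {0..} M \<and> convex_on {0..} M \<and>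
     ((\<lambda>x. M x / x) \<longlongrightarrow> 0) (at_right 0) \<and>
     filterlim (\<lambda>x. M x / x) at_top at_top"

definition smooth_test_function :: "(real \<Rightarrow> real) \<Rightarrow> bool" where
  "smooth_test_function \<psi> \<longleftrightarrow>
     (\<forall>k. ((deriv ^^ k) \<psi>) C1_differentiable_on UNIV) \<and>
     compact (closure {x. \<psi> x \<noteq> 0}) \<and> closure {x. \<psi> x \<noteq> 0} \<subseteq> {0<..}"

definition locally_integrable :: "(real \<Rightarrow> real) \<Rightarrow> bool" where
  "locally_integrable u \<longleftrightarrow> (\<forall>K. compact K \<and> K \<subseteq> {0<..} \<longrightarrow> u absolutely_integrable_on K)"

definition weak_derivative :: "(real \<Rightarrow> real) \<Rightarrow> (real \<Rightarrow> real) \<Rightarrow> bool" where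
  "weak_derivative u v \<longleftrightarrow>
     locally_integrable u \<and> locally_integrable v \<and>
     (\<forall>\<psi>. smooth_test_function \<psi> \<longrightarrow>
        (LINT r:{0<..}|lebesgue. u r * deriv \<psi> r) = - (LINT r:{0<..}|lebesgue. v r * \<psi> r))"

text \<open>
  A set of pairs \<open>(x, y)\<close> stands for a family of non-overlapping intervals; degenerate
  pairs \<open>x = y\<close> contribute nothing to either sum.
\<close>

definition abs_continuous_on_interval :: "real \<Rightarrow> real \<Rightarrow> (real \<Rightarrow> real) \<Rightarrow> bool" where
  "abs_continuous_on_interval a b u \<longleftrightarrow>
     (\<forall>\<epsilon>>0. \<exists>\<delta>>0. \<forall>P :: (real \<times> real) set.
        finite P \<and> (\<forall>(x, y)\<in>P. a \<le> x \<and> x \<le> y \<and> y \<le> b) \<and>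
        pairwise (\<lambda>(x, y) (x', y'). {x<..<y} \<inter> {x'<..<y'} = {}) P \<and>
        (\<Sum>(x, y)\<in>P. y - x) < \<delta>
        \<longrightarrow> (\<Sum>(x, y)\<in>P. \<bar>u y - u x\<bar>) < \<epsilon>)"

definition locally_abs_continuous :: "(real \<Rightarrow> real) \<Rightarrow> bool" where
  "locally_abs_continuous u \<longleftrightarrow> (\<forall>a b. 0 < a \<and> a \<le> b \<longrightarrow> abs_continuous_on_interval a b u)"

text \<open>
  The local Sobolev space on \<open>(0, \<infinity>)\<close>, with each class identified with its locally absolutely
  continuous representative. The weak derivative is determined only almost everywhere.
\<close>

definition W11_loc :: "(real \<Rightarrow> real) set" where
  "W11_loc = {u. locally_integrable u \<and> (\<exists>v. weak_derivative u v) \<and> locally_abs_continuous u}"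

definition set_F :: "(real \<Rightarrow> real) \<Rightarrow> (real \<Rightarrow> real) \<Rightarrow> real set" where
  "set_F \<omega> \<phi> = {r. 0 < r \<and> \<omega> r \<noteq> 0 \<and> deriv \<omega> r * deriv \<phi> r > 0}"

definition set_G :: "(real \<Rightarrow> real) \<Rightarrow> (real \<Rightarrow> real) \<Rightarrow> real set" where
  "set_G \<omega> \<phi> = {r. 0 < r \<and> \<omega> r \<noteq> 0 \<and> deriv \<omega> r * deriv \<phi> r < 0}"

text \<open>
  The functions \<open>b1_at\<close> and \<open>b2_at\<close> depend on \<open>M\<close> only through the constants \<open>d = d_M\<close> and
  \<open>D = D_M\<close>, which are passed instead. Where \<open>\<omega> r = 0\<close> both indicators vanish, so the whole
  last term is 0. The infima and the supremum are taken in the extended reals, so that an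
  unbounded family has an infinite infimum or supremum.
\<close>

definition b1_at :: "real \<Rightarrow> (real \<Rightarrow> real) \<Rightarrow> (real \<Rightarrow> real) \<Rightarrow> real \<Rightarrow> real \<Rightarrow> real" where
  "b1_at r \<omega> \<phi> d D =
     1 + deriv (deriv \<phi>) r / (deriv \<phi> r)\<^sup>2
       - deriv \<omega> r / (\<omega> r * deriv \<phi> r)
         * (d * indicator (set_G \<omega> \<phi>) r + D * indicator (set_F \<omega> \<phi>) r)"

definition b2_at :: "real \<Rightarrow> (real \<Rightarrow> real) \<Rightarrow> (real \<Rightarrow> real) \<Rightarrow> real \<Rightarrow> real \<Rightarrow> real" where
  "b2_at r \<omega> \<phi> d D =
     - 1 - deriv (deriv \<phi>) r / (deriv \<phi> r)\<^sup>2
       + deriv \<omega> r / (\<omega> r * deriv \<phi> r)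
         * (d * indicator (set_F \<omega> \<phi>) r + D * indicator (set_G \<omega> \<phi>) r)"

definition b1 :: "(real \<Rightarrow> real) \<Rightarrow> (real \<Rightarrow> real) \<Rightarrow> real \<Rightarrow> real \<Rightarrow> ereal" where
  "b1 \<omega> \<phi> d D = (INF r\<in>{0<..}. ereal (b1_at r \<omega> \<phi> d D))"

definition b2 :: "(real \<Rightarrow> real) \<Rightarrow> (real \<Rightarrow> real) \<Rightarrow> real \<Rightarrow> real \<Rightarrow> ereal" where
  "b2 \<omega> \<phi> d D = (INF r\<in>{0<..}. ereal (b2_at r \<omega> \<phi> d D))"

definition L_const :: "(real \<Rightarrow> real) \<Rightarrow> (real \<Rightarrow> real) \<Rightarrow> ereal" where
  "L_const \<omega> \<phi> = (SUP r\<in>{0<..}. ereal (\<omega> r / \<bar>deriv \<phi> r\<bar>))"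

definition h_fun ::
    "(real \<Rightarrow> real) \<Rightarrow> (real \<Rightarrow> real) \<Rightarrow> (real \<Rightarrow> real) \<Rightarrow> (real \<Rightarrow> real) \<Rightarrow> real \<Rightarrow> real" where
  "h_fun \<omega> \<phi> M u r = 1 / deriv \<phi> r * M (\<omega> r * \<bar>u r\<bar>)"

definition R_plus :: "(real \<Rightarrow> real) \<Rightarrow> (real \<Rightarrow> real) \<Rightarrow> (real \<Rightarrow> real) \<Rightarrow> (real \<Rightarrow> real) set" where
  "R_plus \<omega> \<phi> M =
     {u \<in> W11_loc. \<exists>s R :: nat \<Rightarrow> real. \<exists>l :: ereal.
        (\<forall>n. 0 < s n) \<and> (\<forall>n. 0 < R n) \<and>
        s \<longlonglongrightarrow> 0 \<and> filterlim R at_top sequentially \<and>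
        (\<lambda>n. ereal (h_fun \<omega> \<phi> M u (R n) * exp (- \<phi> (R n))
                    - h_fun \<omega> \<phi> M u (s n) * exp (- \<phi> (s n)))) \<longlonglongrightarrow> l \<and>
        0 \<le> l}"

definition R_minus :: "(real \<Rightarrow> real) \<Rightarrow> (real \<Rightarrow> real) \<Rightarrow> (real \<Rightarrow> real) \<Rightarrow> (real \<Rightarrow> real) set" where
  "R_minus \<omega> \<phi> M =
     {u \<in> W11_loc. \<exists>s R :: nat \<Rightarrow> real. \<exists>l :: ereal.
        (\<forall>n. 0 < s n) \<and> (\<forall>n. 0 < R n) \<and>
        s \<longlonglongrightarrow> 0 \<and> filterlim R at_top sequentially \<and>
        (\<lambda>n. ereal (h_fun \<omega> \<phi> M u (R n) * exp (- \<phi> (R n))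
                    - h_fun \<omega> \<phi> M u (s n) * exp (- \<phi> (s n)))) \<longlonglongrightarrow> l \<and>
        l \<le> 0}"

definition mu :: "(real \<Rightarrow> real) \<Rightarrow> real measure" where
  "mu \<phi> = density (lebesgue_on {0<..}) (\<lambda>r. ennreal (exp (- \<phi> r)))"

definition c_fun :: "real \<Rightarrow> real \<Rightarrow> real \<Rightarrow> real" where
  "c_fun d D x = max (x powr d) (x powr D)"

end

theory Submission
  imports Defs
begin

text \<open>
  Put \<open>w = exp (- \<phi>)\<close> and \<open>W = M (\<omega> * \<bar>u\<bar>) * w / \<phi>'\<close>, the boundary term \<open>h * exp (- \<phi>)\<close>. Differentiating
  formally,
    \<open>W' = - (1 + \<phi>'' / \<phi>'\<^sup>2) * M * w + \<omega>' / (\<omega> * \<phi>') * (\<omega> * \<bar>u\<bar>) * M' * w + (\<omega> / \<phi>') * M' * \<bar>u\<bar>' * w\<close>,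
  with \<open>M\<close> and \<open>M'\<close> taken at \<open>\<omega> * \<bar>u\<bar>\<close>. The growth bounds
  \<open>d * M \<le> x * M' \<le> D * M\<close>, applied according to the sign of \<open>\<omega>' * \<phi>'\<close>
  (\<open>log_derivative_bounds\<close>), show that the first two terms together are at most \<open>- b * M * w\<close>, where
  \<open>b\<close> is the infimum of \<open>b1_at\<close>; the last term is at most \<open>L * M' * \<bar>u'\<bar> * w\<close>. Convexity gives the Young
  inequality \<open>M' s * t \<le> M t + (D - 1) * M s\<close>; with \<open>t = \<kappa> * \<bar>u'\<bar>\<close> and \<open>\<kappa> = L * D / b\<close> it leaves
    \<open>W' \<le> (b / D) * (M (\<kappa> * \<bar>u'\<bar>) - M (\<omega> * \<bar>u\<bar>)) * w\<close>.
  Integrating over \<open>[s n, R n]\<close> and letting \<open>n\<close> tend to infinity, the sign condition on the boundary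
  terms yields that the integral of \<open>M (\<omega> * \<bar>u\<bar>)\<close> is at most that of \<open>M (\<kappa> * \<bar>u'\<bar>)\<close>
  (\<open>weighted_inequality\<close>), and the growth bounds give \<open>M (\<kappa> * x) \<le> c \<kappa> * M x\<close> (\<open>scaling\<close>). The second part
  is the same computation for \<open>- W\<close>.

  Two points need care because \<open>u\<close> is only a continuous function with a weak derivative. First, the
  weak derivative has to be integrated: \<open>u b - u a\<close> is the integral of \<open>u'\<close>
  (\<open>weak_derivative_imp_has_integral\<close>), which is obtained by testing against an explicit smooth
  approximation of an indicator function. Second, \<open>W\<close> is not differentiable everywhere; the integrated
  inequality is proved by a local first-order expansion and bisection (\<open>energy_inequality\<close>).
\<close>

section \<open>A smooth step function\<close>

text \<open>
  Recursion peels off the innermost derivative, so that closure of \<open>n\<close>-fold differentiability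
  under products and reciprocals follows from the Leibniz and quotient rules by induction on \<open>n\<close>.
\<close>

primrec times_differentiable :: "nat \<Rightarrow> (real \<Rightarrow> real) \<Rightarrow> bool" where
  "times_differentiable 0 f \<longleftrightarrow> True"
| "times_differentiable (Suc n) f \<longleftrightarrow>
     (\<exists>g. (\<forall>x. (f has_real_derivative g x) (at x)) \<and> times_differentiable n g)"

lemma times_differentiable_SucE:
  assumes "times_differentiable (Suc n) f"
  obtains g where "\<And>x. (f has_real_derivative g x) (at x)" "times_differentiable n g"
  using assms unfolding times_differentiable.simps by blast

lemma times_differentiable_SucI:
  assumes "\<And>x. (f has_real_derivative g x) (at x)" "times_differentiable n g"
  shows "times_differentiable (Suc n) f"
  using assms unfolding times_differentiable.simps by blast

lemma times_differentiable_mono: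
  "times_differentiable (Suc n) f \<Longrightarrow> times_differentiable n f"
proof (induction n arbitrary: f)
  case (Suc n)
  obtain g where g: "\<And>x. (f has_real_derivative g x) (at x)" "times_differentiable (Suc n) g"
    using Suc.prems by (rule times_differentiable_SucE) (rule that)
  show ?case
    by (rule times_differentiable_SucI[OF g(1) Suc.IH[OF g(2)]])
qed simp

lemma times_differentiable_const: "times_differentiable n (\<lambda>x. c)"
proof (induction n arbitrary: c)
  case (Suc n)
  show ?case
    by (rule times_differentiable_SucI[OF DERIV_const Suc])
qed simp

lemma times_differentiable_add:
  "times_differentiable n f \<Longrightarrow> times_differentiable n g \<Longrightarrow> times_differentiable n (\<lambda>x. f x + g x)"
proof (induction n arbitrary: f g)
  case (Suc n)
  obtain f' where f': "\<And>x. (f has_real_derivative f' x) (at x)" "times_differentiable n f'"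
    using Suc.prems(1) by (rule times_differentiable_SucE) (rule that)
  obtain g' where g': "\<And>x. (g has_real_derivative g' x) (at x)" "times_differentiable n g'"
    using Suc.prems(2) by (rule times_differentiable_SucE) (rule that)
  show ?case
    by (rule times_differentiable_SucI[OF DERIV_add[OF f'(1) g'(1)] Suc.IH[OF f'(2) g'(2)]])
qed simp

lemma times_differentiable_mult:
  "times_differentiable n f \<Longrightarrow> times_differentiable n g \<Longrightarrow> times_differentiable n (\<lambda>x. f x * g x)"
proof (induction n arbitrary: f g)
  case (Suc n)
  obtain f' where f': "\<And>x. (f has_real_derivative f' x) (at x)" "times_differentiable n f'"
    using Suc.prems(1) by (rule times_differentiable_SucE) (rule that)
  obtain g' where g': "\<And>x. (g has_real_derivative g' x) (at x)" "times_differentiable n g'"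
    using Suc.prems(2) by (rule times_differentiable_SucE) (rule that)
  note fg = Suc.prems[THEN times_differentiable_mono]
  show ?case
    by (rule times_differentiable_SucI[OF DERIV_mult[OF f'(1) g'(1)]
          times_differentiable_add[OF Suc.IH[OF f'(2) fg(2)] Suc.IH[OF g'(2) fg(1)]]])
qed simp

text \<open>
  The derivative \<open>- f' / f\<^sup>2\<close> is again built from the reciprocal of \<open>f\<close> and from \<open>f'\<close>, both of which are
  \<open>n\<close> times differentiable by induction.
\<close>

lemma times_differentiable_inverse:
  "times_differentiable n f \<Longrightarrow> (\<And>x. f x \<noteq> 0) \<Longrightarrow> times_differentiable n (\<lambda>x. inverse (f x))"
proof (induction n arbitrary: f)
  case (Suc n)
  obtain f' where f': "\<And>x. (f has_real_derivative f' x) (at x)" "times_differentiable n f'"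
    using Suc.prems(1) by (rule times_differentiable_SucE) (rule that)
  have I: "times_differentiable n (\<lambda>x. inverse (f x))"
    by (rule Suc.IH[OF times_differentiable_mono[OF Suc.prems(1)] Suc.prems(2)])
  have "times_differentiable n (\<lambda>x. (-1) * (inverse (f x) * f' x * inverse (f x)))"
    by (intro times_differentiable_mult times_differentiable_const I f'(2))
  moreover have "((\<lambda>x. inverse (f x)) has_real_derivative
      (-1) * (inverse (f x) * f' x * inverse (f x))) (at x)" for x
    using DERIV_inverse'[OF f'(1) Suc.prems(2)] by simp
  ultimately show ?case by (rule times_differentiable_SucI[rotated])
qed simp

lemma times_differentiable_affine:
  "times_differentiable n f \<Longrightarrow> times_differentiable n (\<lambda>x. f (k * x + c))"
proof (induction n arbitrary: f)
  case (Suc n)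
  obtain f' where f': "\<And>x. (f has_real_derivative f' x) (at x)" "times_differentiable n f'"
    using Suc.prems(1) by (rule times_differentiable_SucE) (rule that)
  have "((\<lambda>x. f (k * x + c)) has_real_derivative f' (k * x + c) * k) (at x)" for x
    by (rule DERIV_chain2[OF f'(1)]) (auto intro!: derivative_eq_intros)
  then show ?case
    by (rule times_differentiable_SucI[OF _ times_differentiable_mult[OF Suc.IH[OF f'(2)] times_differentiable_const]])
qed simp

lemma times_differentiable_deriv:
  assumes "\<And>n. times_differentiable n f"
  shows "(f has_real_derivative deriv f x) (at x)" "times_differentiable n (deriv f)"
proof -
  obtain g where g: "\<And>x. (f has_real_derivative g x) (at x)" "times_differentiable n g"
    by (rule times_differentiable_SucE[OF assms[of "Suc n"]]) (rule that)
  have "g = deriv f" using DERIV_imp_deriv[OF g(1)] by (simp add: fun_eq_iff)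
  with g show "(f has_real_derivative deriv f x) (at x)" "times_differentiable n (deriv f)"
    by simp_all
qed

lemma funpow_deriv_C1:
  assumes "\<And>n. times_differentiable n f"
  shows "((deriv ^^ k) f) C1_differentiable_on UNIV"
proof -
  have *: "times_differentiable n ((deriv ^^ k) f)" for n k
  proof (induction k arbitrary: n)
    case (Suc k)
    then show ?case using times_differentiable_deriv(2)[of "(deriv ^^ k) f"] by simp
  qed (simp add: assms)
  let ?g = "(deriv ^^ k) f"
  have "(deriv ?g has_real_derivative deriv (deriv ?g) x) (at x)" for x
    using times_differentiable_deriv[OF times_differentiable_deriv(2)[of ?g]] * by blast
  then have "continuous_on UNIV (deriv ?g)"
    by (intro DERIV_continuous_on[where D = "deriv (deriv ?g)"]) (auto intro: has_field_derivative_at_within)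
  moreover have "(?g has_vector_derivative deriv ?g x) (at x)" for x
    using times_differentiable_deriv(1)[of ?g] * by (simp add: has_real_derivative_iff_has_vector_derivative)
  ultimately show ?thesis
    unfolding C1_differentiable_on_def by blast
qed

text \<open>
  For \<open>p = 1\<close> this is Cauchy's flat function \<open>exp (- 1 / x)\<close>. The polynomial factor makes the family
  closed under differentiation.
\<close>

definition poly_exp_inverse :: "real poly \<Rightarrow> real \<Rightarrow> real" where
  "poly_exp_inverse p x = (if x \<le> 0 then 0 else poly p (1 / x) * exp (- (1 / x)))"

lemma poly_times_exp_minus_tendsto_0: "((\<lambda>y::real. poly p y * exp (- y)) \<longlongrightarrow> 0) at_top"
proof -
  have "((\<lambda>y. \<Sum>i\<le>degree p. coeff p i * (y ^ i / exp y)) \<longlongrightarrow> (\<Sum>i\<le>degree p. coeff p i * 0)) at_top"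
    by (intro tendsto_sum tendsto_mult tendsto_const tendsto_power_div_exp_0)
  then show ?thesis
    by (simp add: poly_altdef exp_minus field_simps sum_distrib_right sum_divide_distrib)
qed

text \<open>
  For \<open>x > 0\<close>, with \<open>y = 1 / x\<close>, the chain rule gives \<open>y\<^sup>2 * (p y - p' y) * exp (- y)\<close>. At \<open>0\<close> the right
  difference quotient is \<open>y * p y * exp (- y)\<close>, which tends to \<open>0\<close> as \<open>y\<close> tends to infinity.
\<close>

lemma poly_exp_inverse_has_derivative:
  "(poly_exp_inverse p has_real_derivative
     poly_exp_inverse ([:0, 0, 1:] * (p - pderiv p)) x) (at x)"
proof (cases x "0 :: real" rule: linorder_cases)
  case less
  have "((\<lambda>x. 0) has_real_derivative 0) (at x)" by (rule DERIV_const)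
  then have "(poly_exp_inverse p has_real_derivative 0) (at x)"
    by (rule has_field_derivative_transform_within_open[of _ _ _ "{..<0}"])
      (use less in \<open>auto simp: poly_exp_inverse_def\<close>)
  then show ?thesis using less by (simp add: poly_exp_inverse_def)
next
  case greater
  have "((\<lambda>x. poly p (1 / x) * exp (- (1 / x))) has_real_derivative
      poly ([:0, 0, 1:] * (p - pderiv p)) (1 / x) * exp (- (1 / x))) (at x)"
    using greater
    by (auto intro!: derivative_eq_intros DERIV_chain2[OF poly_DERIV]) (simp add: field_simps power2_eq_square)
  then have "(poly_exp_inverse p has_real_derivative
      poly ([:0, 0, 1:] * (p - pderiv p)) (1 / x) * exp (- (1 / x))) (at x)"
    by (rule has_field_derivative_transform_within_open[of _ _ _ "{0<..}"])
      (use greater in \<open>auto simp: poly_exp_inverse_def\<close>)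
  then show ?thesis
    using greater by (simp add: poly_exp_inverse_def)
next
  case equal
  have "((\<lambda>h. poly_exp_inverse p h / h) \<longlongrightarrow> 0) (at_right 0)"
  proof -
    have "((\<lambda>h::real. poly ([:0,1:] * p) (inverse h) * exp (- inverse h)) \<longlongrightarrow> 0) (at_right 0)"
      by (rule filterlim_compose[OF poly_times_exp_minus_tendsto_0 filterlim_inverse_at_top_right])
    then show ?thesis
      by (rule Lim_transform_eventually)
        (auto simp: poly_exp_inverse_def eventually_at_right_less field_simps
          intro!: eventually_at_rightI[of 0 1])
  qed
  moreover have "((\<lambda>h. poly_exp_inverse p h / h) \<longlongrightarrow> 0) (at_left 0)"
    by (rule Lim_transform_eventually[OF tendsto_const])
      (auto simp: poly_exp_inverse_def intro!: eventually_at_leftI[of "-1"])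
  ultimately have "((\<lambda>h. poly_exp_inverse p h / h) \<longlongrightarrow> 0) (at 0)"
    by (simp add: filterlim_at_split)
  then show ?thesis
    using equal by (simp add: has_field_derivative_iff poly_exp_inverse_def)
qed

lemma times_differentiable_poly_exp_inverse: "times_differentiable n (poly_exp_inverse p)"
proof (induction n arbitrary: p)
  case (Suc n)
  show ?case
    by (rule times_differentiable_SucI[OF poly_exp_inverse_has_derivative Suc])
qed simp

text \<open>
  With \<open>f\<close> the flat function, take \<open>f x / (f x + f (1 - x))\<close>: the denominator is positive because
  \<open>x\<close> and \<open>1 - x\<close> are never both nonpositive.
\<close>

lemma smooth_step_exists:
  obtains H :: "real \<Rightarrow> real"
  where "\<And>n. times_differentiable n H" "\<And>x. x \<le> 0 \<Longrightarrow> H x = 0" "\<And>x. 1 \<le> x \<Longrightarrow> H x = 1"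
    "\<And>x. 0 \<le> H x" "\<And>x. H x \<le> 1"
proof
  let ?f = "poly_exp_inverse 1"
  let ?g = "\<lambda>x. ?f ((-1) * x + 1)"
  let ?H = "\<lambda>x. ?f x * inverse (?f x + ?g x)"
  have nn: "0 \<le> ?f x" for x by (simp add: poly_exp_inverse_def)
  have pos: "0 < ?f x" if "0 < x" for x using that by (simp add: poly_exp_inverse_def)
  have z: "?f x = 0" if "x \<le> 0" for x using that by (simp add: poly_exp_inverse_def)
  have sum: "0 < ?f x + ?g x" for x
    using nn[of x] nn[of "(-1) * x + 1"] pos[of x] pos[of "(-1) * x + 1"] by (cases "0 < x") auto
  show "times_differentiable n ?H" for n
    by (intro times_differentiable_mult times_differentiable_inverse times_differentiable_add
        times_differentiable_affine times_differentiable_poly_exp_inverse) (use sum in \<open>simp add: less_imp_neq[symmetric]\<close>)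
  show "?H x = 0" if "x \<le> 0" for x using z[OF that] by simp
  show "?H x = 1" if "1 \<le> x" for x using z[of "(-1) * x + 1"] pos[of x] that by simp
  show "0 \<le> ?H x" for x using nn sum[of x] by simp
  show "?H x \<le> 1" for x using nn[of "(-1) * x + 1"] sum[of x] by (simp add: field_simps)
qed

section \<open>Integrating a weak derivative\<close>

lemma LINT_half_line_eq_integral:
  fixes f :: "real \<Rightarrow> real"
  assumes "f absolutely_integrable_on {a..b}" "0 < a" "\<And>x. x \<notin> {a..b} \<Longrightarrow> f x = 0"
  shows "(LINT r:{0<..}|lebesgue. f r) = integral {a..b} f"
proof -
  have "f absolutely_integrable_on {0<..}"
  proof (rule iffD1[OF absolutely_integrable_spike_set_eq assms(1)])
    have e: "{x \<in> {a..b} - {0<..}. f x \<noteq> 0} = {}" "{x \<in> {0<..} - {a..b}. f x \<noteq> 0} = {}"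
      using assms(2,3) by auto
    show "negligible {x \<in> {a..b} - {0<..}. f x \<noteq> 0}" "negligible {x \<in> {0<..} - {a..b}. f x \<noteq> 0}"
      unfolding e by simp_all
  qed
  then have "(LINT r:{0<..}|lebesgue. f r) = integral {0<..} f"
    by (rule set_lebesgue_integral_eq_integral(2))
  also have "(f has_integral integral {a..b} f) {0<..}"
  proof (rule has_integral_on_superset)
    show "(f has_integral integral {a..b} f) {a..b}"
      by (rule integrable_integral[OF set_lebesgue_integral_eq_integral(1)[OF assms(1)]])
  qed (use assms(2,3) in auto)
  then have "integral {0<..} f = integral {a..b} f" by (rule integral_unique)
  finally show ?thesis .
qed

text \<open>
  The rescaled derivatives of a step at \<open>a\<close> have integral 1, live on \<open>[a, a + 1 / k]\<close> and are
  bounded by a multiple of \<open>k\<close>. The last property controls their mass in absolute value, as positivity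
  would, so they form an approximate identity at \<open>a\<close>.
\<close>

lemma step_derivative_concentrates:
  fixes u :: "real \<Rightarrow> real"
  assumes H: "\<And>n. times_differentiable n H" "\<And>x. x \<le> 0 \<Longrightarrow> H x = 0" "\<And>x. 1 \<le> x \<Longrightarrow> H x = 1"
    and cd: "c \<le> a" "a + 1 \<le> d"
    and u: "continuous_on {c..d} u"
  shows "(\<lambda>n. integral {c..d} (\<lambda>x. u x * (real (Suc n) * deriv H (real (Suc n) * (x - a))))) \<longlonglongrightarrow> u a"
proof -
  have dH: "(H has_real_derivative deriv H x) (at x)" for x
    using times_differentiable_deriv(1)[of H] H(1) by blast
  have "(deriv H has_real_derivative deriv (deriv H) x) (at x)" for x
    using times_differentiable_deriv[OF times_differentiable_deriv(2)[of H]] H(1) by blast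
  then have cont: "continuous_on S (deriv H)" for S
    by (intro DERIV_continuous_on[where D = "deriv (deriv H)"]) (auto intro: has_field_derivative_at_within)
  have cont': "continuous_on S (\<lambda>x. deriv H (k * (x - a)))" for S k
    by (rule continuous_on_compose2[OF cont[of UNIV]]) (auto intro!: continuous_intros)
  have flat: "deriv H x = 0" if "x \<notin> {0..1}" for x
  proof (cases "x < 0")
    case True
    have "(H has_real_derivative 0) (at x)"
      by (rule has_field_derivative_transform_within_open[OF DERIV_const[of 0], of "{..<0}"])
        (use True H(2) in auto)
    then show ?thesis by (rule DERIV_imp_deriv)
  next
    case False
    have "(H has_real_derivative 0) (at x)"
      by (rule has_field_derivative_transform_within_open[OF DERIV_const[of 1], of "{1<..}"])
        (use that False H(3) in auto)
    then show ?thesis by (rule DERIV_imp_deriv)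
  qed
  have "bounded (deriv H ` {0..1})"
    by (intro compact_imp_bounded compact_continuous_image cont compact_Icc)
  then obtain B where B: "\<And>x. x \<in> {0..1} \<Longrightarrow> \<bar>deriv H x\<bar> \<le> B" "0 < B"
    unfolding bounded_pos ball_simps real_norm_def by blast
  show ?thesis
  proof (rule LIMSEQ_I)
    fix e :: real assume e: "0 < e"
    have "continuous (at a within {c..d}) u"
      using u cd by (auto simp: continuous_on_eq_continuous_within)
    then obtain \<delta> where \<delta>: "0 < \<delta>" "\<And>x. x \<in> {c..d} \<Longrightarrow> \<bar>x - a\<bar> < \<delta> \<Longrightarrow> \<bar>u x - u a\<bar> < e / (2 * B)"
      unfolding continuous_within_eps_delta dist_real_def using e B(2)
      by (metis divide_pos_pos mult_pos_pos zero_less_numeral)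
    obtain N :: nat where N: "1 / \<delta> < real N" using reals_Archimedean2 by blast
    have "norm (integral {c..d} (\<lambda>x. u x * (real (Suc n) * deriv H (real (Suc n) * (x - a)))) - u a) < e"
      if n: "N \<le> n" for n
    proof -
      define k where "k = real (Suc n)"
      have k: "0 < k" "1 \<le> k" "1 / k < \<delta>"
      proof -
        show "0 < k" "1 \<le> k" by (simp_all add: k_def)
        have "1 / \<delta> < k" using N n by (simp add: k_def)
        then show "1 / k < \<delta>" using \<delta>(1) \<open>0 < k\<close> by (simp add: field_simps)
      qed
      have "((\<lambda>x. k * deriv H (k * (x - a))) has_integral H (k * (d - a)) - H (k * (c - a))) {c..d}"
      proof (rule fundamental_theorem_of_calculus)
        show "((\<lambda>x. H (k * (x - a))) has_vector_derivative k * deriv H (k * (x - a))) (at x within {c..d})" for x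
          unfolding has_real_derivative_iff_has_vector_derivative[symmetric]
          by (rule DERIV_cong[OF DERIV_chain2[OF dH]]) (auto intro!: derivative_eq_intros)
      qed (use cd in auto)
      moreover have "H (k * (d - a)) - H (k * (c - a)) = 1"
      proof -
        have "k * (c - a) \<le> 0" using cd k by (simp add: mult_le_0_iff)
        moreover have "1 * 1 \<le> k * (d - a)" using cd k by (intro mult_mono) auto
        ultimately show ?thesis by (simp add: H(2,3))
      qed
      ultimately have "((\<lambda>x. k * deriv H (k * (x - a))) has_integral 1) {c..d}" by simp
      from has_integral_mult_right[OF this, of "u a"]
      have one: "((\<lambda>x. u a * (k * deriv H (k * (x - a)))) has_integral u a) {c..d}" by simp
      have sub: "{a..a + 1 / k} \<subseteq> {c..d}"
      proof -
        have "1 / k \<le> 1" using k by simp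
        then show ?thesis using cd by auto
      qed
      have uint: "(\<lambda>x. u x * (k * deriv H (k * (x - a)))) integrable_on {c..d}"
        by (intro integrable_continuous_real continuous_intros u cont')
      have "integral {c..d} (\<lambda>x. u x * (k * deriv H (k * (x - a)))) - u a
          = integral {c..d} (\<lambda>x. u x * (k * deriv H (k * (x - a))) - u a * (k * deriv H (k * (x - a))))"
        using one uint by (subst integral_diff) (auto simp: has_integral_iff)
      also have "\<dots> = integral {c..d} (\<lambda>x. (u x - u a) * (k * deriv H (k * (x - a))))"
        by (simp add: left_diff_distrib)
      also have "\<dots> = integral {a..a + 1 / k} (\<lambda>x. (u x - u a) * (k * deriv H (k * (x - a))))"
      proof (rule integral_unique, rule has_integral_on_superset)
        show "((\<lambda>x. (u x - u a) * (k * deriv H (k * (x - a)))) has_integral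
            integral {a..a + 1 / k} (\<lambda>x. (u x - u a) * (k * deriv H (k * (x - a))))) {a..a + 1 / k}"
          by (intro integrable_integral integrable_continuous_real continuous_intros cont'
              continuous_on_subset[OF u] sub)
        show "{a..a + 1 / k} \<subseteq> {c..d}" by (rule sub)
        show "(u x - u a) * (k * deriv H (k * (x - a))) = 0" if "x \<notin> {a..a + 1 / k}" for x
          using that k flat[of "k * (x - a)"] by (auto simp: field_simps zero_le_mult_iff)
      qed
      also have "norm \<dots> \<le> (e / (2 * B) * (k * B)) * ((a + 1 / k) - a)"
      proof (rule integral_bound)
        show "continuous_on {a..a + 1 / k} (\<lambda>x. (u x - u a) * (k * deriv H (k * (x - a))))"
          by (intro continuous_intros cont' continuous_on_subset[OF u] sub)
        fix x assume x: "x \<in> {a..a + 1 / k}"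
        have kx: "k * (x - a) \<in> {0..1}" using x k by (auto simp: field_simps)
        have "\<bar>u x - u a\<bar> < e / (2 * B)"
          using x k sub by (intro \<delta>(2)) auto
        then have "\<bar>u x - u a\<bar> * (k * \<bar>deriv H (k * (x - a))\<bar>) \<le> e / (2 * B) * (k * B)"
          using B(1)[OF kx] k e B(2) by (intro mult_mono) auto
        then show "norm ((u x - u a) * (k * deriv H (k * (x - a)))) \<le> e / (2 * B) * (k * B)"
          using k by (simp add: abs_mult)
      qed (use k in auto)
      also have "\<dots> = e / 2" using k B(2) by simp
      also have "\<dots> < e" using e by simp
      finally show ?thesis by (simp add: k_def)
    qed
    then show "\<exists>N. \<forall>n\<ge>N. norm (integral {c..d} (\<lambda>x. u x * (real (Suc n) * deriv H (real (Suc n) * (x - a)))) - u a) < e"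
      by blast
  qed
qed

text \<open>
  The fundamental theorem of calculus for weak derivatives. The test functions
  \<open>\<psi> n = H (n (x - a)) - H (n (x - b))\<close> are smooth approximations of the indicator of \<open>(a, b]\<close>.
  Their derivatives converge to a unit mass at \<open>a\<close> minus one at \<open>b\<close>, so the left side of the defining
  identity tends to \<open>u a - u b\<close>, while the right side tends to minus the integral of \<open>v\<close> by dominated
  convergence. Testing with one explicit family avoids the density argument of the du Bois-Reymond
  lemma.
\<close>

lemma weak_derivative_imp_has_integral:
  assumes w: "weak_derivative u v" and u: "continuous_on {0<..} u" and ab: "0 < a" "a \<le> b"
  shows "(v has_integral (u b - u a)) {a..b}"
proof -
  obtain H :: "real \<Rightarrow> real" where H: "\<And>n. times_differentiable n H" "\<And>x. x \<le> 0 \<Longrightarrow> H x = 0"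
    "\<And>x. 1 \<le> x \<Longrightarrow> H x = 1" "\<And>x. 0 \<le> H x" "\<And>x. H x \<le> 1"
    by (rule smooth_step_exists) (rule that)
  have dH: "(H has_real_derivative deriv H x) (at x)" for x
    using times_differentiable_deriv(1)[of H] H(1) by blast
  \<comment> \<open>\<open>Suc n\<close> rather than \<open>n\<close> keeps the scale at least 1, so that all supports lie in \<open>[a, b + 1]\<close>.\<close>
  define k where "k n = real (Suc n)" for n
  have k: "0 < k n" "1 \<le> k n" for n by (simp_all add: k_def)
  define \<psi> where "\<psi> n x = H (k n * (x - a)) - H (k n * (x - b))" for n x
  have d\<psi>: "(\<psi> n has_real_derivative k n * deriv H (k n * (x - a)) - k n * deriv H (k n * (x - b))) (at x)" for n x
    unfolding \<psi>_def by (auto intro!: derivative_eq_intros DERIV_chain2[OF dH])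
  then have deriv\<psi>: "deriv (\<psi> n) = (\<lambda>x. k n * deriv H (k n * (x - a)) - k n * deriv H (k n * (x - b)))" for n
    using DERIV_imp_deriv by (intro ext) blast
  have \<psi>0: "\<psi> n x = 0" if "x \<notin> {a..b + 1}" for n x
  proof (cases "x < a")
    case True
    then have "k n * (x - a) \<le> 0" "k n * (x - b) \<le> 0"
      using k[of n] ab by (auto simp: mult_le_0_iff)
    then show ?thesis by (simp add: \<psi>_def H(2))
  next
    case False
    then have x: "b + 1 < x" using that by simp
    have "1 * 1 \<le> k n * (x - b)" "1 * 1 \<le> k n * (x - a)"
      using x ab k[of n] by (intro mult_mono; simp)+
    then show ?thesis by (simp add: \<psi>_def H(3))
  qed
  have sup: "closure {x. \<psi> n x \<noteq> 0} \<subseteq> {a..b + 1}" for n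
  proof (rule closure_minimal)
    show "{x. \<psi> n x \<noteq> 0} \<subseteq> {a..b + 1}" using \<psi>0 by blast
  qed simp
  have td\<psi>: "times_differentiable m (\<psi> n)" for m n
  proof -
    have "times_differentiable m (\<lambda>x. H (k n * x + - (k n * a)) + (-1) * H (k n * x + - (k n * b)))"
      by (intro times_differentiable_add times_differentiable_mult times_differentiable_const
          times_differentiable_affine H(1))
    then show ?thesis by (simp add: \<psi>_def[abs_def] right_diff_distrib)
  qed
  have test: "smooth_test_function (\<psi> n)" for n
    unfolding smooth_test_function_def
  proof (intro conjI allI)
    show "((deriv ^^ m) (\<psi> n)) C1_differentiable_on UNIV" for m
      by (rule funpow_deriv_C1[OF td\<psi>])
    show "compact (closure {x. \<psi> n x \<noteq> 0})"
      by (rule compact_closure[THEN iffD2, OF bounded_subset[OF bounded_closed_interval[of a "b + 1"]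
            order_trans[OF closure_subset sup]]])
    show "closure {x. \<psi> n x \<noteq> 0} \<subseteq> {0<..}"
      using sup[of n] ab by auto
  qed
  have deriv\<psi>0: "deriv (\<psi> n) x = 0" if "x \<notin> {a..b + 1}" for n x
  proof -
    have "(\<psi> n has_real_derivative 0) (at x)"
      by (rule has_field_derivative_transform_within_open[OF DERIV_const[of 0], of "- {a..b + 1}"])
        (use that \<psi>0 in auto)
    then show ?thesis by (rule DERIV_imp_deriv)
  qed
  have cont\<psi>: "continuous_on S (\<psi> n)" for S n
    by (rule DERIV_continuous_on[OF has_field_derivative_at_within[OF d\<psi>]])
  have contd: "continuous_on S (deriv (\<psi> n))" for S n
    by (rule DERIV_continuous_on[OF has_field_derivative_at_within[OF
          times_differentiable_deriv(1)[OF times_differentiable_deriv(2)[OF td\<psi>]]]])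
  have uc: "continuous_on {c..d} u" if "0 < c" for c d
    by (rule continuous_on_subset[OF u]) (use that in auto)
  have v: "v absolutely_integrable_on {c..d}" if "0 < c" for c d
  proof -
    have "compact {c..d}" "{c..d} \<subseteq> {0<..}" using that by auto
    then show ?thesis using w unfolding weak_derivative_def locally_integrable_def by blast
  qed
  have Lu: "(LINT r:{0<..}|lebesgue. u r * deriv (\<psi> n) r) = integral {a..b + 1} (\<lambda>r. u r * deriv (\<psi> n) r)" for n
    using ab by (intro LINT_half_line_eq_integral absolutely_integrable_continuous_real
        continuous_intros contd uc) (auto simp: deriv\<psi>0)
  have v\<psi>: "(\<lambda>r. v r * \<psi> n r) absolutely_integrable_on {a..b + 1}" for n
  proof -
    have "(\<lambda>r. \<psi> n r * v r) absolutely_integrable_on {a..b + 1}"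
      by (intro absolutely_integrable_bounded_measurable_product_real v ab
          continuous_imp_measurable_on_sets_lebesgue cont\<psi> compact_imp_bounded compact_continuous_image) auto
    then show ?thesis by (simp add: mult.commute)
  qed
  have Lv: "(LINT r:{0<..}|lebesgue. v r * \<psi> n r) = integral {a..b + 1} (\<lambda>r. v r * \<psi> n r)" for n
    using ab by (intro LINT_half_line_eq_integral v\<psi>) (auto simp: \<psi>0)
  have eq: "integral {a..b + 1} (\<lambda>r. u r * deriv (\<psi> n) r) = - integral {a..b + 1} (\<lambda>r. v r * \<psi> n r)" for n
  proof -
    have "(LINT r:{0<..}|lebesgue. u r * deriv (\<psi> n) r) = - (LINT r:{0<..}|lebesgue. v r * \<psi> n r)"
      using w test[of n] unfolding weak_derivative_def by blast
    then show ?thesis unfolding Lu Lv .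
  qed
  have contdH: "continuous_on UNIV (deriv H)"
    by (rule DERIV_continuous_on[OF has_field_derivative_at_within[OF
          times_differentiable_deriv(1)[OF times_differentiable_deriv(2)[OF H(1)]]]])
  have contH: "continuous_on S (\<lambda>x. deriv H (c * (x - e)))" for S c e
    by (rule continuous_on_compose2[OF contdH]) (auto intro!: continuous_intros)
  have split: "integral {a..b + 1} (\<lambda>r. u r * deriv (\<psi> n) r)
     = integral {a..b + 1} (\<lambda>x. u x * (k n * deriv H (k n * (x - a))))
       - integral {a..b + 1} (\<lambda>x. u x * (k n * deriv H (k n * (x - b))))" for n
  proof -
    have "(\<lambda>x. u x * (k n * deriv H (k n * (x - c)))) integrable_on {a..b + 1}" for c
      by (intro integrable_continuous_real continuous_on_mult continuous_on_const contH uc ab)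
    from integral_diff[OF this[of a] this[of b]] show ?thesis
      by (simp only: deriv\<psi> right_diff_distrib)
  qed
  have "(\<lambda>n. integral {a..b + 1} (\<lambda>r. u r * deriv (\<psi> n) r)) \<longlonglongrightarrow> u a - u b"
    unfolding split k_def using ab
    by (intro tendsto_diff step_derivative_concentrates[OF H(1-3)] uc) auto
  moreover
  have "(\<lambda>n. integral {a..b + 1} (\<lambda>r. v r * \<psi> n r)) \<longlonglongrightarrow> integral {a..b + 1} (\<lambda>r. if r \<in> {a<..b} then v r else 0)"
  proof (rule dominated_convergence(2))
    show "(\<lambda>r. v r * \<psi> n r) integrable_on {a..b + 1}" for n
      by (rule set_lebesgue_integral_eq_integral(1)[OF v\<psi>])
    show "(\<lambda>r. \<bar>v r\<bar>) integrable_on {a..b + 1}"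
      using v[of a "b + 1"] ab unfolding absolutely_integrable_on_def by simp
    show "norm (v x * \<psi> n x) \<le> \<bar>v x\<bar>" for n x
    proof -
      have "\<bar>\<psi> n x\<bar> \<le> 1"
        unfolding \<psi>_def using H(4,5)[of "k n * (x - a)"] H(4,5)[of "k n * (x - b)"] by auto
      then show ?thesis by (simp add: abs_mult mult_left_le)
    qed
    show "(\<lambda>n. v x * \<psi> n x) \<longlonglongrightarrow> (if x \<in> {a<..b} then v x else 0)" if x: "x \<in> {a..b + 1}" for x
    proof -
      have ev: "eventually (\<lambda>n. H (k n * y) = (if 0 < y then 1 else 0)) sequentially" for y
      proof (cases "0 < y")
        case True
        have "eventually (\<lambda>n. 1 / y \<le> real n) sequentially"
          by (rule filterlim_at_top[THEN iffD1, rule_format, OF filterlim_real_sequentially])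
        then show ?thesis
          by eventually_elim (use True in \<open>auto intro!: H(3) simp: k_def field_simps\<close>)
      next
        case False
        then show ?thesis using k by (auto intro!: always_eventually H(2) simp: mult_le_0_iff less_imp_le)
      qed
      have "eventually (\<lambda>n. v x * \<psi> n x = (if x \<in> {a<..b} then v x else 0)) sequentially"
        using ev[of "x - a"] ev[of "x - b"]
        by eventually_elim (use ab x in \<open>auto simp: \<psi>_def\<close>)
      then show ?thesis by (rule tendsto_eventually)
    qed
  qed
  from tendsto_minus[OF this]
  have "(\<lambda>n. integral {a..b + 1} (\<lambda>r. u r * deriv (\<psi> n) r))
      \<longlonglongrightarrow> - integral {a..b + 1} (\<lambda>r. if r \<in> {a<..b} then v r else 0)"
    unfolding eq .
  ultimately have "u a - u b = - integral {a..b + 1} (\<lambda>r. if r \<in> {a<..b} then v r else 0)"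
    by (rule LIMSEQ_unique)
  then have "- (u a - u b) = integral {a..b + 1} (\<lambda>r. if r \<in> {a<..b} then v r else 0)" by simp
  also have "\<dots> = integral {a..b} v"
  proof -
    have "integral {a..b + 1} (\<lambda>r. if r \<in> {a<..b} then v r else 0) = integral {a<..b} v"
      by (subst integral_restrict_Int) (auto intro!: arg_cong2[where f = integral])
    also have "\<dots> = integral {a..b} v"
      by (rule integral_spike_set) (auto intro: negligible_subset[of "{a}"])
    finally show ?thesis .
  qed
  finally have "integral {a..b} v = u b - u a" by simp
  moreover have "v integrable_on {a..b}"
    by (rule set_lebesgue_integral_eq_integral(1)[OF v[OF ab(1)]])
  ultimately show ?thesis by (simp add: has_integral_iff)
qed

section \<open>N-functions of power-type growth\<close>

locale power_type_N_function =
  fixes M :: "real \<Rightarrow> real" and d D :: real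
  assumes N_function: "N_function M"
    and differentiable: "M differentiable_on {0..}"
    and d_ge_1: "1 \<le> d" and d_le_D: "d \<le> D"
    and deriv_bounds: "\<And>x. 0 < x \<Longrightarrow> d * (M x / x) \<le> deriv M x \<and> deriv M x \<le> D * (M x / x)"
begin

lemma D_ge_1: "1 \<le> D"
  using d_ge_1 d_le_D by simp

lemma nonneg: "0 \<le> x \<Longrightarrow> 0 \<le> M x"
  using N_function by (simp add: N_function_def)

lemma at_zero: "M 0 = 0"
proof (rule tendsto_unique)
  have "((\<lambda>x. x * (M x / x)) \<longlongrightarrow> 0 * 0) (at_right 0)"
    using N_function unfolding N_function_def by (intro tendsto_intros) auto
  then have "((\<lambda>x. x * (M x / x)) \<longlongrightarrow> 0) (at_right 0)"
    by (simp only: mult_zero_left)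
  moreover have "eventually (\<lambda>x. x * (M x / x) = M x) (at_right 0)"
    using eventually_at_right_less[of 0] by eventually_elim simp
  ultimately show "(M \<longlongrightarrow> 0) (at_right 0)"
    by (rule Lim_transform_eventually)
next
  have "continuous (at 0 within {0..}) M"
    using N_function by (auto simp: N_function_def continuous_on_eq_continuous_within)
  then show "(M \<longlongrightarrow> M 0) (at_right 0)"
    unfolding continuous_within by (rule tendsto_within_subset) auto
qed simp

lemma has_deriv:
  assumes "0 < x"
  shows "(M has_real_derivative deriv M x) (at x)"
proof -
  have "M differentiable at x within {0..}"
    using differentiable assms by (auto simp: differentiable_on_def)
  moreover have "at x within {0..} = at x"
    using assms by (intro at_within_interior) simp
  ultimately show ?thesis
    by (simp add: DERIV_deriv_iff_real_differentiable)
qed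

lemma deriv_nonneg: "0 < x \<Longrightarrow> 0 \<le> deriv M x"
  using deriv_bounds[of x] nonneg[of x] d_ge_1 by (smt (verit) divide_nonneg_pos mult_nonneg_nonneg)

text \<open>
  The derivative of the even extension \<open>y \<mapsto> M \<bar>y\<bar>\<close>. The factor \<open>sgn y\<close> makes it \<open>0\<close> at \<open>0\<close>, whatever
  the two-sided \<open>deriv M 0\<close> may be.
\<close>

definition even_deriv :: "real \<Rightarrow> real" where
  "even_deriv y = sgn y * deriv M \<bar>y\<bar>"

text \<open>
  At \<open>0\<close> the difference quotients are \<open>M h / h\<close> up to sign, which tend to \<open>0\<close> for an N-function. So
  \<open>M (\<omega> * \<bar>u\<bar>)\<close> is a differentiable function of the signed quantity \<open>\<omega> * u\<close>, and the zeros of \<open>u\<close>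
  need no separate treatment.
\<close>

lemma even_has_derivative: "((\<lambda>y. M \<bar>y\<bar>) has_real_derivative even_deriv y) (at y)"
proof (cases y "0 :: real" rule: linorder_cases)
  case less
  have "((\<lambda>y. M (- y)) has_real_derivative deriv M (- y) * (- 1)) (at y)"
    using less by (intro DERIV_chain2[OF has_deriv]) (auto intro!: derivative_eq_intros)
  then have "((\<lambda>y. M \<bar>y\<bar>) has_real_derivative deriv M (- y) * (- 1)) (at y)"
    by (rule has_field_derivative_transform_within_open[of _ _ _ "{..<0}"]) (use less in auto)
  then show ?thesis using less by (simp add: even_deriv_def)
next
  case greater
  have "((\<lambda>y. M \<bar>y\<bar>) has_real_derivative deriv M y) (at y)"
    by (rule has_field_derivative_transform_within_open[OF has_deriv[OF greater], of "{0<..}"])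
      (use greater in auto)
  then show ?thesis using greater by (simp add: even_deriv_def)
next
  case equal
  have lim: "((\<lambda>h. M h / h) \<longlongrightarrow> 0) (at_right 0)"
    using N_function by (simp add: N_function_def)
  have "((\<lambda>h. M \<bar>h\<bar> / h) \<longlongrightarrow> 0) (at_right 0)"
    by (rule Lim_transform_eventually[OF lim]) (auto intro!: eventually_at_rightI[of 0 1])
  moreover have "((\<lambda>h. M \<bar>h\<bar> / h) \<longlongrightarrow> 0) (at_left 0)"
  proof -
    have "((\<lambda>h. - (M h / h)) \<longlongrightarrow> - 0) (at_right 0)"
      by (intro tendsto_minus lim)
    then have "((\<lambda>h. M \<bar>- h\<bar> / (- h)) \<longlongrightarrow> - 0) (at_right 0)"
      by (rule Lim_transform_eventually) (auto intro!: eventually_at_rightI[of 0 1])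
    then show ?thesis
      by (simp add: filterlim_at_left_to_right)
  qed
  ultimately have "((\<lambda>h. M \<bar>h\<bar> / h) \<longlongrightarrow> 0) (at 0)"
    by (simp add: filterlim_at_split)
  then show ?thesis
    using equal by (simp add: has_field_derivative_iff at_zero even_deriv_def)
qed

lemma even_deriv_bounds:
  "d * M \<bar>y\<bar> \<le> y * even_deriv y" "y * even_deriv y \<le> D * M \<bar>y\<bar>"
proof -
  have "y * even_deriv y = \<bar>y\<bar> * deriv M \<bar>y\<bar>"
    by (simp add: even_deriv_def abs_sgn)
  then show "d * M \<bar>y\<bar> \<le> y * even_deriv y" "y * even_deriv y \<le> D * M \<bar>y\<bar>"
    using deriv_bounds[of "\<bar>y\<bar>"] at_zero by (cases "y = 0"; simp add: field_simps)+
qed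

text \<open>
  The tangent of the convex function \<open>M\<close> at \<open>s = \<bar>y\<bar>\<close> lies below its graph at \<open>t\<close>, that is
  \<open>M' s * t \<le> M t + (s * M' s - M s)\<close>, and \<open>s * M' s \<le> D * M s\<close>.
\<close>

lemma young_inequality:
  assumes "0 \<le> t"
  shows "\<bar>even_deriv y\<bar> * t \<le> M t + (D - 1) * M \<bar>y\<bar>"
proof (cases "y = 0")
  case True
  then show ?thesis using nonneg[OF assms] at_zero by (simp add: even_deriv_def)
next
  case False
  define s where "s = \<bar>y\<bar>"
  have s: "0 < s" using False by (simp add: s_def)
  have "M s + deriv M s * (t - s) \<le> M t"
  proof -
    have "convex_on {0..} M" using N_function by (simp add: N_function_def)
    then have "M t - M s \<ge> deriv M s * (t - s)"
      using s assms
      by (intro convex_on_imp_above_tangent[of "{0..}" M s t]) (auto intro: has_deriv has_field_derivative_at_within)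
    then show ?thesis by simp
  qed
  moreover have "deriv M s * s \<le> D * M s"
    using deriv_bounds[OF s] s by (simp add: field_simps)
  moreover have "\<bar>even_deriv y\<bar> = deriv M s"
    using False deriv_nonneg[OF s] by (simp add: even_deriv_def abs_mult s_def)
  ultimately show ?thesis by (simp add: algebra_simps s_def)
qed

lemma powr_quotient_deriv:
  assumes "0 < x"
  shows "((\<lambda>x. M x * x powr (- p)) has_real_derivative x powr (- p) * (deriv M x - p * (M x / x))) (at x)"
  using assms
  by (auto intro!: derivative_eq_intros has_deriv simp: powr_diff algebra_simps)

text \<open>
  The growth bounds say that \<open>M x / x powr d\<close> is nondecreasing and \<open>M x / x powr D\<close> nonincreasing.
  The latter is compared at \<open>x \<le> k * x\<close> if \<open>k \<ge> 1\<close>, the former at \<open>k * x \<le> x\<close> if \<open>k \<le> 1\<close>.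
\<close>

lemma scaling:
  assumes "0 \<le> k" "0 \<le> x"
  shows "M (k * x) \<le> c_fun d D k * M x"
proof (cases "k = 0 \<or> x = 0")
  case True
  then show ?thesis using at_zero nonneg[OF assms(2)] by (auto simp: c_fun_def intro!: mult_nonneg_nonneg)
next
  case False
  with assms have k: "0 < k" and x: "0 < x" by auto
  have kx: "0 < k * x" using k x by simp
  note Mx = nonneg[OF assms(2)]
  have *: "M (k * x) \<le> k powr p * M x" if "M (k * x) * (k * x) powr (- p) \<le> M x * x powr (- p)" for p
  proof -
    have "M (k * x) * (k * x) powr (- p) * (k * x) powr p \<le> M x * x powr (- p) * (k * x) powr p"
      using that by (rule mult_right_mono) simp
    then show ?thesis
      using k x by (simp add: powr_minus powr_mult field_simps)
  qed
  have "M (k * x) \<le> k powr D * M x" if "1 \<le> k"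
  proof (rule *, rule DERIV_nonpos_imp_nonincreasing[of x "k * x"])
    show "x \<le> k * x" using that x by simp
    fix z assume "x \<le> z" "z \<le> k * x"
    then have z: "0 < z" using x by simp
    show "\<exists>y. ((\<lambda>x. M x * x powr (- D)) has_real_derivative y) (at z) \<and> y \<le> 0"
      using powr_quotient_deriv[OF z, of D] deriv_bounds[OF z]
      by (intro exI conjI) (auto intro!: mult_nonneg_nonpos)
  qed
  moreover have "M (k * x) \<le> k powr d * M x" if "k \<le> 1"
  proof (rule *, rule DERIV_nonneg_imp_nondecreasing[of "k * x" x])
    show "k * x \<le> x" using that x by (simp add: mult_left_le_one_le k less_imp_le)
    fix z assume "k * x \<le> z" "z \<le> x"
    then have z: "0 < z" using kx by simp
    show "\<exists>y. ((\<lambda>x. M x * x powr (- d)) has_real_derivative y) (at z) \<and> 0 \<le> y"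
      using powr_quotient_deriv[OF z, of d] deriv_bounds[OF z]
      by (intro exI conjI) (auto intro!: mult_nonneg_nonneg)
  qed
  moreover have "k powr D * M x \<le> c_fun d D k * M x" "k powr d * M x \<le> c_fun d D k * M x"
    using Mx by (auto simp: c_fun_def intro!: mult_right_mono)
  ultimately show ?thesis by linarith
qed

end

section \<open>The energy inequality on a compact interval\<close>

context power_type_N_function
begin

text \<open>
  Absorption of the mixed term. Writing \<open>L * \<bar>v\<bar>\<close> as \<open>b / D\<close> times \<open>\<kappa> * \<bar>v\<bar>\<close> with \<open>\<kappa> = L * D / b\<close>, the Young
  inequality uses up the fraction \<open>(D - 1) / D\<close> of \<open>- b * w * M \<bar>y\<bar>\<close> and leaves \<open>1 / D\<close> of it.
\<close>

lemma pointwise_young: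
  assumes "0 < b" "0 \<le> L" "\<bar>\<beta>\<bar> \<le> L * w * \<bar>even_deriv y\<bar>" "0 \<le> w" "\<alpha> \<le> - b * (w * M \<bar>y\<bar>)"
  shows "\<alpha> + \<bar>\<beta>\<bar> * \<bar>v\<bar> \<le> b / D * (w * M (L * D / b * \<bar>v\<bar>) - w * M \<bar>y\<bar>)"
proof -
  have D: "0 < D" using D_ge_1 by simp
  have "\<bar>\<beta>\<bar> * \<bar>v\<bar> \<le> L * w * \<bar>even_deriv y\<bar> * \<bar>v\<bar>"
    using assms(3) by (rule mult_right_mono) simp
  also have "\<dots> = b / D * w * (\<bar>even_deriv y\<bar> * (L * D / b * \<bar>v\<bar>))"
    using assms(1) D by simp
  also have "\<dots> \<le> b / D * w * (M (L * D / b * \<bar>v\<bar>) + (D - 1) * M \<bar>y\<bar>)"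
    using assms D by (intro mult_left_mono young_inequality) auto
  finally have "\<alpha> + \<bar>\<beta>\<bar> * \<bar>v\<bar> \<le> - b * (w * M \<bar>y\<bar>) + b / D * w * (M (L * D / b * \<bar>v\<bar>) + (D - 1) * M \<bar>y\<bar>)"
    using assms(5) by linarith
  also have "\<dots> = b / D * (w * M (L * D / b * \<bar>v\<bar>) - w * M \<bar>y\<bar>)"
    using D by (simp add: field_simps)
  finally show ?thesis .
qed

text \<open>
  A first-order expansion in the two increments \<open>y - x\<close> and \<open>u y - u x\<close>, coming from total
  differentiability of \<open>(r, z) \<mapsto> A r * M \<bar>\<omega> r * z\<bar>\<close> at \<open>(x, u x)\<close>. The
  increment of \<open>u\<close> is left as it stands and is controlled later by the integral of its weak derivative.
\<close>

lemma composite_increment: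
  fixes A \<omega> u :: "real \<Rightarrow> real"
  assumes A: "(A has_real_derivative A') (at x)" and \<omega>: "(\<omega> has_real_derivative \<omega>') (at x)"
    and u: "isCont u x" and e: "0 < e"
  shows "eventually (\<lambda>y. \<bar>A y * M \<bar>\<omega> y * u y\<bar> - A x * M \<bar>\<omega> x * u x\<bar>
      - (A' * M \<bar>\<omega> x * u x\<bar> + A x * even_deriv (\<omega> x * u x) * \<omega>' * u x) * (y - x)
      - A x * even_deriv (\<omega> x * u x) * \<omega> x * (u y - u x)\<bar> \<le> e * (\<bar>y - x\<bar> + \<bar>u y - u x\<bar>)) (nhds x)"
proof -
  define \<Phi> where "\<Phi> p = A (fst p) * M \<bar>\<omega> (fst p) * snd p\<bar>" for p :: "real \<times> real"
  define \<Phi>' where "\<Phi>' p = (A' * M \<bar>\<omega> x * u x\<bar> + A x * even_deriv (\<omega> x * u x) * \<omega>' * u x) * fst p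
     + A x * even_deriv (\<omega> x * u x) * \<omega> x * snd p" for p :: "real \<times> real"
  have "(\<Phi> has_derivative \<Phi>') (at (x, u x))"
  proof -
    have f: "((\<lambda>p. A (fst p)) has_derivative (\<lambda>p. fst p * A')) (at (x, u x))"
      by (rule DERIV_compose_FDERIV) (auto intro!: A derivative_eq_intros)
    have g: "((\<lambda>p. \<omega> (fst p)) has_derivative (\<lambda>p. fst p * \<omega>')) (at (x, u x))"
      by (rule DERIV_compose_FDERIV) (auto intro!: \<omega> derivative_eq_intros)
    have h: "((\<lambda>p. \<omega> (fst p) * snd p) has_derivative (\<lambda>p. \<omega> x * snd p + fst p * \<omega>' * u x)) (at (x, u x))"
      using has_derivative_mult[OF g has_derivative_snd[OF has_derivative_ident]] by simp
    have k: "((\<lambda>p. M \<bar>\<omega> (fst p) * snd p\<bar>) has_derivative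
        (\<lambda>p. (\<omega> x * snd p + fst p * \<omega>' * u x) * even_deriv (\<omega> x * u x))) (at (x, u x))"
      by (rule DERIV_compose_FDERIV[OF _ h]) (simp add: even_has_derivative)
    show ?thesis
      unfolding \<Phi>_def[abs_def]
      by (rule has_derivative_eq_rhs[OF has_derivative_mult[OF f k]])
        (simp add: fun_eq_iff \<Phi>'_def algebra_simps)
  qed
  then obtain \<delta> where \<delta>: "0 < \<delta>"
    "\<And>p. norm (p - (x, u x)) < \<delta> \<Longrightarrow> norm (\<Phi> p - \<Phi> (x, u x) - \<Phi>' (p - (x, u x))) \<le> e * norm (p - (x, u x))"
    using e unfolding has_derivative_at_alt by blast
  have "((\<lambda>y. (y, u y)) \<longlongrightarrow> (x, u x)) (nhds x)"
    using u unfolding isCont_def by (intro tendsto_Pair) (auto simp: tendsto_at_iff_tendsto_nhds filterlim_ident)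
  then have "eventually (\<lambda>y. norm ((y, u y) - (x, u x)) < \<delta>) (nhds x)"
    using \<delta>(1) by (auto dest: tendstoD simp: dist_norm)
  then show ?thesis
  proof eventually_elim
    case (elim y)
    have "norm ((y, u y) - (x, u x)) \<le> \<bar>y - x\<bar> + \<bar>u y - u x\<bar>"
      using norm_Pair_le[of "y - x" "u y - u x"] by simp
    then have "e * norm ((y, u y) - (x, u x)) \<le> e * (\<bar>y - x\<bar> + \<bar>u y - u x\<bar>)"
      using e by (intro mult_left_mono) auto
    from order_trans[OF \<delta>(2)[OF elim] this] show ?case
      by (simp add: \<Phi>_def \<Phi>'_def diff_diff_eq add.assoc)
  qed
qed

text \<open>
  Formally one integrates the derivative of \<open>W r = A r * M \<bar>\<omega> r * u r\<bar>\<close> over \<open>[s, R]\<close>, where hypothesis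
  \<open>decay\<close> bounds the part of \<open>W'\<close> without \<open>u'\<close> and hypothesis \<open>coeff\<close> the factor of \<open>u'\<close>. Differentiating
  \<open>W\<close> almost everywhere would require the theory of absolutely continuous functions. Instead,
  for each \<open>e > 0\<close> the inequality with integrand \<open>F e\<close>, the desired integrand plus \<open>e\<close> times an
  integrable error, is shown on all short intervals around each point: there the increment of \<open>W\<close>
  is expanded to first order, the increment of \<open>u\<close> is bounded by the integral of \<open>\<bar>v\<bar>\<close>, and the Young
  inequality is applied with \<open>\<omega> * u\<close> fixed at the centre. The inequality is additive over adjacent
  intervals, so bisection carries it to \<open>[s, R]\<close>, and then \<open>e\<close> tends to \<open>0\<close>.
\<close>

lemma energy_inequality:
  fixes A \<omega> u v w A' \<omega>' :: "real \<Rightarrow> real"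
  assumes b: "0 < b" and L: "0 \<le> L" and sR: "0 < s" "s \<le> R"
    and A: "\<And>r. 0 < r \<Longrightarrow> (A has_real_derivative A' r) (at r)"
    and \<omega>: "\<And>r. 0 < r \<Longrightarrow> (\<omega> has_real_derivative \<omega>' r) (at r)"
    and w: "continuous_on {0<..} w" "\<And>r. 0 < r \<Longrightarrow> 0 < w r"
    and decay: "\<And>r y. 0 < r \<Longrightarrow>
      A' r * M \<bar>\<omega> r * y\<bar> + A r * even_deriv (\<omega> r * y) * \<omega>' r * y \<le> - b * (w r * M \<bar>\<omega> r * y\<bar>)"
    and coeff: "\<And>r. 0 < r \<Longrightarrow> \<bar>A r * \<omega> r\<bar> \<le> L * w r"
    and u: "continuous_on {0<..} u"
    and v: "\<And>x y. 0 < x \<Longrightarrow> x \<le> y \<Longrightarrow> (v has_integral (u y - u x)) {x..y}" "v absolutely_integrable_on {s..R}"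
    and q: "(\<lambda>r. w r * M (L * D / b * \<bar>v r\<bar>)) integrable_on {s..R}"
  shows "A R * M \<bar>\<omega> R * u R\<bar> - A s * M \<bar>\<omega> s * u s\<bar>
    \<le> b / D * (integral {s..R} (\<lambda>r. w r * M (L * D / b * \<bar>v r\<bar>)) - integral {s..R} (\<lambda>r. w r * M \<bar>\<omega> r * u r\<bar>))"
proof -
  define W where "W r = A r * M \<bar>\<omega> r * u r\<bar>" for r
  define p where "p r = w r * M \<bar>\<omega> r * u r\<bar>" for r
  define q where "q r = w r * M (L * D / b * \<bar>v r\<bar>)" for r
  \<comment> \<open>\<open>1 + \<bar>v r\<bar>\<close> pays for the remainder of the expansion of \<open>W\<close>, \<open>q r + 1\<close> for moving \<open>w\<close> and \<open>p\<close> off the centre.\<close>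
  define err where "err r = 1 + \<bar>v r\<bar> + b / D * (q r + 1)" for r
  have D: "0 < D" using D_ge_1 by simp
  have q0: "0 \<le> q r" if "0 < r" for r
    using w(2)[OF that] L D b by (auto simp: q_def intro!: mult_nonneg_nonneg nonneg)
  have cu: "isCont u r" and cw: "isCont w r" and c\<omega>: "isCont \<omega> r" if "0 < r" for r
  proof -
    have "open {0 :: real<..}" by simp
    with u w(1) that show "isCont u r" "isCont w r"
      by (simp_all add: continuous_on_eq_continuous_at)
    show "isCont \<omega> r" by (rule DERIV_isCont[OF \<omega>[OF that]])
  qed
  have cp: "isCont p r" if "0 < r" for r
  proof -
    have "isCont (\<lambda>r. M \<bar>\<omega> r * u r\<bar>) r"
      by (rule isCont_o2[OF isCont_mult[OF c\<omega>[OF that] cu[OF that]] DERIV_isCont[OF even_has_derivative]])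
    then show ?thesis unfolding p_def by (rule isCont_mult[OF cw[OF that]])
  qed
  have int_p: "p integrable_on {x..y}" if "s \<le> x" for x y
    using that sR by (intro integrable_continuous_real continuous_at_imp_continuous_on ballI cp) auto
  have int_q: "q integrable_on {x..y}" if "s \<le> x" "y \<le> R" for x y
    using q unfolding q_def by (rule integrable_on_subinterval) (use that in auto)
  have int_v: "(\<lambda>r. \<bar>v r\<bar>) integrable_on {x..y}" if "s \<le> x" "y \<le> R" for x y
  proof (rule integrable_on_subinterval)
    show "(\<lambda>r. \<bar>v r\<bar>) integrable_on {s..R}" using v(2) by (simp add: absolutely_integrable_on_def)
  qed (use that in auto)
  have int_err: "err integrable_on {x..y}" if "s \<le> x" "y \<le> R" for x y
    unfolding err_def[abs_def]
    by (intro integrable_add integrable_on_mult_right integrable_const_ivl int_v int_q that)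
  define F where "F e r = b / D * (q r - p r) + e * err r" for e r
  have int_F: "F e integrable_on {x..y}" if "s \<le> x" "y \<le> R" for x y e
    unfolding F_def[abs_def]
    by (intro integrable_add integrable_diff integrable_on_mult_right int_err int_p int_q that)
  have main: "W R - W s \<le> integral {s..R} (F e)" if e: "0 < e" for e
  proof -
    define P where "P x y \<longleftrightarrow> (s \<le> x \<and> y \<le> R \<longrightarrow> W y - W x \<le> integral {x..y} (F e))" for x y
    have "P s R"
      using sR(2)
    proof (induction rule: Bolzano)
      case (trans x y z)
      show ?case
        unfolding P_def
      proof (intro impI)
        assume *: "s \<le> x \<and> z \<le> R"
        have "W z - W x \<le> integral {x..y} (F e) + integral {y..z} (F e)"
          using trans * by (auto simp: P_def)
        also have "\<dots> = integral {x..z} (F e)"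
          using trans * by (intro Henstock_Kurzweil_Integration.integral_combine int_F) auto
        finally show "W z - W x \<le> integral {x..z} (F e)" .
      qed
    next
      case (local x)
      have x: "0 < x" using local sR by simp
      define \<alpha> where "\<alpha> = A' x * M \<bar>\<omega> x * u x\<bar> + A x * even_deriv (\<omega> x * u x) * \<omega>' x * u x"
      define \<beta> where "\<beta> = A x * even_deriv (\<omega> x * u x) * \<omega> x"
      have \<alpha>: "\<alpha> \<le> - b * (w x * M \<bar>\<omega> x * u x\<bar>)"
        unfolding \<alpha>_def by (rule decay[OF x])
      have \<beta>: "\<bar>\<beta>\<bar> \<le> L * w x * \<bar>even_deriv (\<omega> x * u x)\<bar>"
        using mult_right_mono[OF coeff[OF x], of "\<bar>even_deriv (\<omega> x * u x)\<bar>"]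
        by (simp add: \<beta>_def abs_mult mult_ac)
      have ev1: "eventually (\<lambda>y. \<bar>W y - W x - \<alpha> * (y - x) - \<beta> * (u y - u x)\<bar> \<le> e * (\<bar>y - x\<bar> + \<bar>u y - u x\<bar>)) (nhds x)"
        unfolding W_def \<alpha>_def \<beta>_def by (rule composite_increment[OF A[OF x] \<omega>[OF x] cu[OF x] e])
      have ev2: "eventually (\<lambda>y. p y < p x + e) (nhds x)"
        using cp[OF x] e unfolding isCont_def tendsto_at_iff_tendsto_nhds
        by (intro order_tendstoD(2)) auto
      have ev3: "eventually (\<lambda>y. w x < (1 + e) * w y) (nhds x)"
      proof -
        have "((\<lambda>y. (1 + e) * w y) \<longlongrightarrow> (1 + e) * w x) (nhds x)"
          using cw[OF x] unfolding isCont_def tendsto_at_iff_tendsto_nhds by (intro tendsto_intros)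
        then show ?thesis
          by (rule order_tendstoD(1)) (use w(2)[OF x] e in simp)
      qed
      obtain \<delta> where \<delta>: "0 < \<delta>" "\<And>y. dist y x < \<delta> \<Longrightarrow>
          \<bar>W y - W x - \<alpha> * (y - x) - \<beta> * (u y - u x)\<bar> \<le> e * (\<bar>y - x\<bar> + \<bar>u y - u x\<bar>)
          \<and> p y < p x + e \<and> w x < (1 + e) * w y"
        using eventually_conj[OF ev1 eventually_conj[OF ev2 ev3]]
        unfolding eventually_nhds_metric by blast
      show ?case
        unfolding P_def
      proof (intro exI[of _ \<delta>] conjI \<delta>(1) allI impI, elim conjE)
        fix y z assume yz: "y \<le> x" "x \<le> z" "z - y < \<delta>" "s \<le> y" "z \<le> R"
        have y0: "0 < y" using yz sR by simp
        have Iv: "\<bar>u t' - u t\<bar> \<le> integral {t..t'} (\<lambda>r. \<bar>v r\<bar>)" if "y \<le> t" "t \<le> t'" "t' \<le> z" for t t'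
        proof -
          have "norm (integral {t..t'} v) \<le> integral {t..t'} (\<lambda>r. \<bar>v r\<bar>)"
            using v(1)[of t t'] that y0 yz
            by (intro integral_norm_bound_integral int_v) (auto simp: has_integral_iff)
          then show ?thesis using v(1)[of t t'] that y0 by (auto simp: has_integral_iff)
        qed
        have Ivz: "integral {y..x} (\<lambda>r. \<bar>v r\<bar>) + integral {x..z} (\<lambda>r. \<bar>v r\<bar>) = integral {y..z} (\<lambda>r. \<bar>v r\<bar>)"
          using yz by (intro Henstock_Kurzweil_Integration.integral_combine int_v) auto
        have "W z - W y \<le> \<alpha> * (z - y) + \<beta> * (u z - u y)
            + e * (\<bar>z - x\<bar> + \<bar>u z - u x\<bar>) + e * (\<bar>y - x\<bar> + \<bar>u y - u x\<bar>)"
        proof -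
          have "W z - W x \<le> \<alpha> * (z - x) + \<beta> * (u z - u x) + e * (\<bar>z - x\<bar> + \<bar>u z - u x\<bar>)"
            using \<delta>(2)[of z] yz by (auto simp: dist_real_def)
          moreover have "W x - W y \<le> - \<alpha> * (y - x) - \<beta> * (u y - u x) + e * (\<bar>y - x\<bar> + \<bar>u y - u x\<bar>)"
            using \<delta>(2)[of y] yz by (auto simp: dist_real_def)
          ultimately show ?thesis by (simp add: algebra_simps)
        qed
        also have "\<dots> \<le> \<alpha> * (z - y) + \<bar>\<beta>\<bar> * integral {y..z} (\<lambda>r. \<bar>v r\<bar>)
            + e * ((z - y) + integral {y..z} (\<lambda>r. \<bar>v r\<bar>))"
        proof -
          have "\<beta> * (u z - u y) \<le> \<bar>\<beta>\<bar> * \<bar>u z - u y\<bar>"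
            by (metis abs_ge_self abs_mult)
          also have "\<dots> \<le> \<bar>\<beta>\<bar> * integral {y..z} (\<lambda>r. \<bar>v r\<bar>)"
            using yz by (intro mult_left_mono Iv) auto
          finally have 1: "\<beta> * (u z - u y) \<le> \<bar>\<beta>\<bar> * integral {y..z} (\<lambda>r. \<bar>v r\<bar>)" .
          have "(\<bar>z - x\<bar> + \<bar>u z - u x\<bar>) + (\<bar>y - x\<bar> + \<bar>u y - u x\<bar>) \<le> (z - y) + integral {y..z} (\<lambda>r. \<bar>v r\<bar>)"
            using Iv[of x z] Iv[of y x] Ivz yz by (auto simp: abs_minus_commute)
          then have "e * ((\<bar>z - x\<bar> + \<bar>u z - u x\<bar>) + (\<bar>y - x\<bar> + \<bar>u y - u x\<bar>)) \<le> e * ((z - y) + integral {y..z} (\<lambda>r. \<bar>v r\<bar>))"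
            using e by (intro mult_left_mono) auto
          with 1 show ?thesis by (simp add: distrib_left)
        qed
        also have "\<dots> = integral {y..z} (\<lambda>r. (\<alpha> + e) + (\<bar>\<beta>\<bar> + e) * \<bar>v r\<bar>)"
        proof -
          have "(\<lambda>r. (\<bar>\<beta>\<bar> + e) * \<bar>v r\<bar>) integrable_on {y..z}"
            using yz by (intro integrable_on_mult_right int_v)
          then have "integral {y..z} (\<lambda>r. (\<alpha> + e) + (\<bar>\<beta>\<bar> + e) * \<bar>v r\<bar>)
              = (z - y) * (\<alpha> + e) + (\<bar>\<beta>\<bar> + e) * integral {y..z} (\<lambda>r. \<bar>v r\<bar>)"
            using yz by (subst integral_add) auto
          then show ?thesis by (simp add: algebra_simps)
        qed
        also have "\<dots> \<le> integral {y..z} (F e)"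
        proof (rule integral_le)
          show "(\<lambda>r. (\<alpha> + e) + (\<bar>\<beta>\<bar> + e) * \<bar>v r\<bar>) integrable_on {y..z}"
            using yz by (intro integrable_add integrable_on_mult_right integrable_const_ivl int_v)
          show "F e integrable_on {y..z}" using yz by (intro int_F)
          fix t assume t: "t \<in> {y..z}"
          have t0: "0 < t" using t y0 by simp
          have near: "p t \<le> p x + e" "w x \<le> (1 + e) * w t"
          proof -
            have "dist t x < \<delta>" using t yz by (auto simp: dist_real_def abs_if)
            from \<delta>(2)[OF this] show "p t \<le> p x + e" "w x \<le> (1 + e) * w t" by auto
          qed
          have "\<alpha> + \<bar>\<beta>\<bar> * \<bar>v t\<bar> \<le> b / D * (w x * M (L * D / b * \<bar>v t\<bar>) - p x)"
            unfolding p_def by (rule pointwise_young[OF b L \<beta> less_imp_le[OF w(2)[OF x]] \<alpha>])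
          \<comment> \<open>Continuity of \<open>w\<close> and \<open>p\<close> replaces the centre \<open>x\<close> by \<open>t\<close>; the error in \<open>w\<close> is relative because \<open>M (L * D / b * \<bar>v t\<bar>)\<close> may be unbounded near \<open>x\<close>.\<close>
          also have "\<dots> \<le> b / D * ((1 + e) * w t * M (L * D / b * \<bar>v t\<bar>) - (p t - e))"
            using near b D L by (intro mult_left_mono diff_mono mult_right_mono nonneg) auto
          also have "\<dots> = b / D * (q t - p t) + e * (b / D * (q t + 1))"
            by (simp add: q_def algebra_simps)
          finally show "(\<alpha> + e) + (\<bar>\<beta>\<bar> + e) * \<bar>v t\<bar> \<le> F e t"
            by (simp add: F_def err_def algebra_simps)
        qed
        finally show "W z - W y \<le> integral {y..z} (F e)" .
      qed
    qed
    then show ?thesis by (simp add: P_def)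
  qed
  define E where "E = integral {s..R} err"
  define I where "I = b / D * (integral {s..R} q - integral {s..R} p)"
  have "integral {s..R} (F e) = I + e * E" for e
  proof -
    have "integral {s..R} (F e) = integral {s..R} (\<lambda>r. b / D * (q r - p r)) + integral {s..R} (\<lambda>r. e * err r)"
      unfolding F_def[abs_def]
      by (intro integral_add integrable_on_mult_right integrable_diff int_p int_q int_err order_refl)
    also have "integral {s..R} (\<lambda>r. b / D * (q r - p r)) = I"
      unfolding I_def integral_mult_right
      by (intro arg_cong2[where f = "(*)"] refl integral_diff int_p int_q order_refl)
    finally show ?thesis by (simp add: E_def)
  qed
  with main have bound: "W R - W s \<le> I + e * E" if "0 < e" for e using that by simp
  have "0 \<le> E"
    unfolding E_def using b D sR q0
    by (intro integral_nonneg int_err) (auto simp: err_def intro!: add_nonneg_nonneg mult_nonneg_nonneg)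
  have "W R - W s \<le> I"
  proof (rule field_le_epsilon)
    fix e :: real assume "0 < e"
    then have "W R - W s \<le> I + e / (E + 1) * E"
      using \<open>0 \<le> E\<close> by (intro bound) simp
    also have "e / (E + 1) * E \<le> e"
      using \<open>0 \<le> E\<close> \<open>0 < e\<close> by (simp add: field_simps)
    finally show "W R - W s \<le> I + e" by simp
  qed
  then show ?thesis unfolding W_def I_def p_def q_def .
qed

end

section \<open>Passage to the half-line\<close>

lemma locally_abs_continuous_imp_continuous_on:
  assumes "locally_abs_continuous u"
  shows "continuous_on {0<..} u"
  unfolding continuous_on_iff
proof (intro ballI allI impI)
  fix x e :: real assume "x \<in> {0<..}" and e: "0 < e"
  then have x: "0 < x" by simp
  then have "abs_continuous_on_interval (x / 2) (2 * x) u"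
    using assms by (auto simp: locally_abs_continuous_def)
  from this[unfolded abs_continuous_on_interval_def, THEN spec[of _ e], THEN mp, OF e]
  have "\<exists>\<delta>>0. \<forall>P :: (real \<times> real) set.
        finite P \<and> (\<forall>(y, z)\<in>P. x / 2 \<le> y \<and> y \<le> z \<and> z \<le> 2 * x) \<and>
        pairwise (\<lambda>(x, y) (x', y'). {x<..<y} \<inter> {x'<..<y'} = {}) P \<and>
        (\<Sum>(y, z)\<in>P. z - y) < \<delta> \<longrightarrow> (\<Sum>(y, z)\<in>P. \<bar>u z - u y\<bar>) < e"
    .
  then obtain \<delta> where \<delta>: "0 < \<delta>" and P: "\<forall>P :: (real \<times> real) set.
        finite P \<and> (\<forall>(y, z)\<in>P. x / 2 \<le> y \<and> y \<le> z \<and> z \<le> 2 * x) \<and>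
        pairwise (\<lambda>(x, y) (x', y'). {x<..<y} \<inter> {x'<..<y'} = {}) P \<and>
        (\<Sum>(y, z)\<in>P. z - y) < \<delta> \<longrightarrow> (\<Sum>(y, z)\<in>P. \<bar>u z - u y\<bar>) < e"
    by (elim exE conjE)
  have one: "\<bar>u z - u y\<bar> < e" if "x / 2 \<le> y" "y \<le> z" "z \<le> 2 * x" "z - y < \<delta>" for y z
    using P[THEN spec, of "{(y, z)}"] that by (simp add: pairwise_def)
  show "\<exists>d>0. \<forall>y\<in>{0<..}. dist y x < d \<longrightarrow> dist (u y) (u x) < e"
  proof (intro exI[of _ "min \<delta> (x / 2)"] conjI ballI impI)
    show "0 < min \<delta> (x / 2)" using \<delta> x by simp
    fix y assume "dist y x < min \<delta> (x / 2)"
    then have y: "\<bar>y - x\<bar> < \<delta>" "\<bar>y - x\<bar> < x / 2" by (simp_all add: dist_real_def)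
    show "dist (u y) (u x) < e"
    proof (cases "y \<le> x")
      case True
      have "\<bar>u x - u y\<bar> < e" by (rule one) (use y x True in \<open>simp_all add: abs_if split: if_splits\<close>)
      then show ?thesis by (simp add: dist_real_def abs_minus_commute)
    next
      case False
      have "\<bar>u y - u x\<bar> < e" by (rule one) (use y x False in \<open>simp_all add: abs_if split: if_splits\<close>)
      then show ?thesis by (simp add: dist_real_def)
    qed
  qed
qed

text \<open>
  Monotone convergence along the exhaustion of the half-line by the intervals \<open>[1 / n, n]\<close>.
\<close>

lemma nn_integral_half_line_le:
  fixes p :: "real \<Rightarrow> real"
  assumes p: "continuous_on {0<..} p" "\<And>r. 0 < r \<Longrightarrow> 0 \<le> p r"
    and K: "\<And>a c. 0 < a \<Longrightarrow> a \<le> c \<Longrightarrow> integral {a..c} p \<le> K"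
  shows "(\<integral>\<^sup>+ r. ennreal (p r) \<partial>lebesgue_on {0<..}) \<le> ennreal K"
proof -
  define I where "I n = {1 / real (Suc n)..real (Suc n)}" for n
  have Ipos: "I n \<subseteq> {0<..}" for n
    by (auto simp: I_def intro: less_le_trans[rotated])
  have pm: "p \<in> borel_measurable (lebesgue_on {0<..})"
    by (intro continuous_imp_measurable_on_sets_lebesgue p(1)) simp
  define f where "f n r = ennreal (p r) * indicator (I n) r" for n r
  have mono: "I m \<subseteq> I n" if "m \<le> n" for m n
    using that by (auto simp: I_def intro: order_trans[rotated] divide_left_mono)
  have "incseq f"
  proof (rule incseq_SucI, rule le_funI)
    show "f n r \<le> f (Suc n) r" for n r
      using mono[of n "Suc n"] by (auto simp: f_def split: split_indicator)
  qed
  have meas: "f n \<in> borel_measurable (lebesgue_on {0<..})" for n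
  proof -
    have [measurable]: "I n \<in> sets (lebesgue_on {0<..})"
      using Ipos[of n] by (auto simp: sets_restrict_space_iff I_def)
    show ?thesis unfolding f_def[abs_def] using pm by measurable
  qed
  have sup: "ennreal (p r) = (SUP n. f n r)" if r: "0 < r" for r
  proof (rule antisym)
    obtain n :: nat where n: "max r (1 / r) < real n" using reals_Archimedean2 by blast
    then have "r \<in> I n"
      using r by (auto simp: I_def field_simps)
    then show "ennreal (p r) \<le> (SUP n. f n r)"
      by (intro SUP_upper2[of n]) (auto simp: f_def)
    show "(SUP n. f n r) \<le> ennreal (p r)"
      by (intro SUP_least) (auto simp: f_def split: split_indicator)
  qed
  have part: "(\<integral>\<^sup>+ r. f n r \<partial>lebesgue_on {0<..}) \<le> ennreal K" for n
  proof -
    have In: "0 < 1 / real (Suc n)" "1 / real (Suc n) \<le> real (Suc n)"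
      by (auto simp: field_simps)
    have "(\<integral>\<^sup>+ r. f n r \<partial>lebesgue_on {0<..}) = (\<integral>\<^sup>+ r. f n r * indicator {0<..} r \<partial>lebesgue)"
      by (intro nn_integral_restrict_space) simp
    also have "\<dots> = (\<integral>\<^sup>+ r. ennreal (p r) * indicator (I n) r \<partial>lebesgue)"
      using Ipos[of n] by (intro nn_integral_cong) (auto simp: f_def split: split_indicator)
    also have "\<dots> = (\<integral>\<^sup>+ r. ennreal (p r) \<partial>lebesgue_on (I n))"
      by (intro nn_integral_restrict_space[symmetric]) (simp add: I_def)
    also have "\<dots> = ennreal (integral\<^sup>L (lebesgue_on (I n)) p)"
    proof (rule nn_integral_eq_integral)
      show "integrable (lebesgue_on (I n)) p"
        unfolding I_def box_real(2)[symmetric]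
        by (intro continuous_imp_integrable continuous_on_subset[OF p(1)]) (use Ipos[of n] in \<open>auto simp: I_def\<close>)
      show "AE r in lebesgue_on (I n). 0 \<le> p r"
        using Ipos[of n] p(2) by (intro AE_I2) (auto simp: space_restrict_space)
    qed
    also have "integral\<^sup>L (lebesgue_on (I n)) p = integral (I n) p"
    proof (rule lebesgue_integral_eq_integral)
      show "integrable (lebesgue_on (I n)) p"
        unfolding I_def box_real(2)[symmetric]
        by (intro continuous_imp_integrable continuous_on_subset[OF p(1)]) (use Ipos[of n] in \<open>auto simp: I_def\<close>)
    qed (simp add: I_def)
    also have "\<dots> \<le> K"
      unfolding I_def by (rule K[OF In])
    finally show ?thesis by (simp add: ennreal_leI)
  qed
  have "(\<integral>\<^sup>+ r. ennreal (p r) \<partial>lebesgue_on {0<..}) = (\<integral>\<^sup>+ r. (SUP n. f n r) \<partial>lebesgue_on {0<..})"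
    by (intro nn_integral_cong sup) (auto simp: space_restrict_space)
  also have "\<dots> = (SUP n. \<integral>\<^sup>+ r. f n r \<partial>lebesgue_on {0<..})"
    by (rule nn_integral_monotone_convergence_SUP[OF \<open>incseq f\<close> meas])
  also have "\<dots> \<le> ennreal K"
    by (intro SUP_least part)
  finally show ?thesis .
qed

lemma locally_integrable_imp_measurable:
  assumes "locally_integrable v"
  shows "v \<in> borel_measurable (lebesgue_on {0<..})"
proof -
  define I where "I n = {1 / real (Suc n)..real (Suc n)}" for n
  have meas: "(\<lambda>x. indicator (I n) x * v x) \<in> borel_measurable lebesgue" for n
  proof -
    have "compact (I n)" "I n \<subseteq> {0<..}"
      by (auto simp: I_def intro: less_le_trans[rotated])
    then have "v absolutely_integrable_on (I n)"
      using assms unfolding locally_integrable_def by blast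
    then show ?thesis
      unfolding set_integrable_def by (auto dest: borel_measurable_integrable)
  qed
  have lim: "(\<lambda>n. indicator (I n) x * v x) \<longlonglongrightarrow> indicator {0<..} x * v x" for x
  proof (cases "0 < x")
    case True
    obtain N :: nat where N: "max x (1 / x) < real N" using reals_Archimedean2 by blast
    have "eventually (\<lambda>n. indicator (I n) x * v x = indicator {0<..} x * v x) sequentially"
      using eventually_ge_at_top[of N]
    proof eventually_elim
      case (elim n)
      then have "max x (1 / x) < real (Suc n)" using N by simp
      then have "x \<in> I n" using True by (auto simp: I_def field_simps)
      then show ?case using True by simp
    qed
    then show ?thesis by (rule tendsto_eventually)
  next
    case False
    then have "x \<notin> I n" for n by (auto simp: I_def intro: less_le_trans[rotated])
    then show ?thesis using False by simp
  qed
  have "(\<lambda>x. indicator {0<..} x * v x) \<in> borel_measurable lebesgue"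
    by (rule borel_measurable_LIMSEQ_real[OF lim meas])
  then show ?thesis
    by (subst borel_measurable_restrict_space_iff) auto
qed

context power_type_N_function
begin

text \<open>
  The energy inequality on \<open>[s n, R n]\<close> bounds the boundary increment by \<open>b / D\<close> times the difference
  of the integrals of \<open>q = w * M (L * D / b * \<bar>v\<bar>)\<close> and \<open>p = w * M \<bar>\<omega> * u\<bar>\<close>. If the integral of \<open>p\<close> over some \<open>[a, c]\<close> exceeded the full integral \<open>K\<close> of \<open>q\<close>,
  then the boundary increments would stay below a fixed negative number as soon as \<open>[s n, R n]\<close>
  contains \<open>[a, c]\<close>, contradicting \<open>l \<ge> 0\<close>.
\<close>

lemma weighted_inequality:
  fixes A \<omega> u v w A' \<omega>' :: "real \<Rightarrow> real" and s R :: "nat \<Rightarrow> real" and l :: ereal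
  assumes b: "0 < b" and L: "0 \<le> L"
    and A: "\<And>r. 0 < r \<Longrightarrow> (A has_real_derivative A' r) (at r)"
    and \<omega>: "\<And>r. 0 < r \<Longrightarrow> (\<omega> has_real_derivative \<omega>' r) (at r)"
    and w: "continuous_on {0<..} w" "\<And>r. 0 < r \<Longrightarrow> 0 < w r"
    and decay: "\<And>r y. 0 < r \<Longrightarrow>
      A' r * M \<bar>\<omega> r * y\<bar> + A r * even_deriv (\<omega> r * y) * \<omega>' r * y \<le> - b * (w r * M \<bar>\<omega> r * y\<bar>)"
    and coeff: "\<And>r. 0 < r \<Longrightarrow> \<bar>A r * \<omega> r\<bar> \<le> L * w r"
    and u: "continuous_on {0<..} u" and v: "weak_derivative u v"
    and s: "\<And>n. 0 < s n" "s \<longlonglongrightarrow> 0" and R: "filterlim R at_top sequentially"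
    and l: "(\<lambda>n. ereal (A (R n) * M \<bar>\<omega> (R n) * u (R n)\<bar> - A (s n) * M \<bar>\<omega> (s n) * u (s n)\<bar>)) \<longlonglongrightarrow> l" "0 \<le> l"
  shows "(\<integral>\<^sup>+ r. ennreal (w r * M \<bar>\<omega> r * u r\<bar>) \<partial>lebesgue_on {0<..})
    \<le> (\<integral>\<^sup>+ r. ennreal (w r * M (L * D / b * \<bar>v r\<bar>)) \<partial>lebesgue_on {0<..})"
proof (cases "(\<integral>\<^sup>+ r. ennreal (w r * M (L * D / b * \<bar>v r\<bar>)) \<partial>lebesgue_on {0<..}) = \<infinity>")
  case False
  define W where "W r = A r * M \<bar>\<omega> r * u r\<bar>" for r
  define p where "p r = w r * M \<bar>\<omega> r * u r\<bar>" for r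
  define q where "q r = w r * M (L * D / b * \<bar>v r\<bar>)" for r
  have D: "0 < D" using D_ge_1 by simp
  have cM: "continuous_on UNIV (\<lambda>y. M \<bar>y\<bar>)"
    by (rule DERIV_continuous_on[OF has_field_derivative_at_within[OF even_has_derivative]])
  have c\<omega>: "continuous_on {0<..} \<omega>"
    by (rule DERIV_continuous_on[OF has_field_derivative_at_within[OF \<omega>]]) simp
  have cp: "continuous_on {0<..} p"
    unfolding p_def by (intro continuous_on_mult w(1) continuous_on_compose2[OF cM] c\<omega> u subset_UNIV)
  have p0: "0 \<le> p r" if "0 < r" for r
    using w(2)[OF that] by (auto simp: p_def intro!: mult_nonneg_nonneg nonneg)
  have q0: "0 \<le> q r" if "0 < r" for r
    using w(2)[OF that] L D b by (auto simp: q_def intro!: mult_nonneg_nonneg nonneg)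
  have vm: "v \<in> borel_measurable (lebesgue_on {0<..})"
    using v by (intro locally_integrable_imp_measurable) (simp add: weak_derivative_def)
  have qm: "q \<in> borel_measurable (lebesgue_on {0<..})"
  proof -
    have "(\<lambda>y. M \<bar>y\<bar>) \<in> borel_measurable borel"
      by (rule borel_measurable_continuous_onI[OF cM])
    then have "(\<lambda>r. M \<bar>L * D / b * v r\<bar>) \<in> borel_measurable (lebesgue_on {0<..})"
      by (rule measurable_compose[rotated]) (use vm in measurable)
    moreover have "w \<in> borel_measurable (lebesgue_on {0<..})"
      by (intro continuous_imp_measurable_on_sets_lebesgue w(1)) simp
    moreover have "\<bar>L * D / b * v r\<bar> = L * D / b * \<bar>v r\<bar>" for r
      using L D b by (simp add: abs_mult)
    ultimately show ?thesis unfolding q_def by simp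
  qed
  have qi: "integrable (lebesgue_on {0<..}) q"
  proof (rule integrableI_nonneg[OF qm])
    show "AE r in lebesgue_on {0<..}. 0 \<le> q r"
      using q0 by (intro AE_I2) (simp add: space_restrict_space)
    show "(\<integral>\<^sup>+ r. ennreal (q r) \<partial>lebesgue_on {0<..}) < \<infinity>"
      using False unfolding q_def by (simp add: less_top)
  qed
  define K where "K = integral {0<..} q"
  have qK: "(\<integral>\<^sup>+ r. ennreal (q r) \<partial>lebesgue_on {0<..}) = ennreal K"
  proof -
    have "(\<integral>\<^sup>+ r. ennreal (q r) \<partial>lebesgue_on {0<..}) = ennreal (integral\<^sup>L (lebesgue_on {0<..}) q)"
      using qi q0 by (intro nn_integral_eq_integral AE_I2) (simp_all add: space_restrict_space)
    also have "integral\<^sup>L (lebesgue_on {0<..}) q = K"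
      unfolding K_def using qi by (intro lebesgue_integral_eq_integral) simp_all
    finally show ?thesis .
  qed
  have qhk: "q integrable_on {0<..}"
    using qi by (intro integrable_on_lebesgue_on) simp_all
  have qsub: "q integrable_on {x..y}" if "0 < x" for x y
  proof -
    have "q absolutely_integrable_on {0<..}"
      using qhk q0 by (subst absolutely_integrable_on_iff_nonneg) auto
    then have "q absolutely_integrable_on {x..y}"
      by (rule set_integrable_subset) (use that in auto)
    then show ?thesis by (rule set_lebesgue_integral_eq_integral(1))
  qed
  have vabs: "v absolutely_integrable_on {x..y}" if "0 < x" for x y
  proof -
    have "compact {x..y}" "{x..y} \<subseteq> {0<..}" using that by auto
    then show ?thesis using v unfolding weak_derivative_def locally_integrable_def by blast
  qed
  have step: "W y - W x \<le> b / D * (K - integral {x..y} p)" if "0 < x" "x \<le> y" for x y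
  proof -
    have qK: "integral {x..y} q \<le> K"
      unfolding K_def using that q0 by (intro integral_subset_le qsub qhk) auto
    have "W y - W x \<le> b / D * (integral {x..y} q - integral {x..y} p)"
      unfolding W_def p_def q_def
      using that
      by (intro energy_inequality[OF b L that A \<omega> w decay coeff u]
          weak_derivative_imp_has_integral[OF v u] vabs qsub[unfolded q_def]) auto
    also have "\<dots> \<le> b / D * (K - integral {x..y} p)"
      using qK b D by (intro mult_left_mono) auto
    finally show ?thesis .
  qed
  have bound: "integral {a..c} p \<le> K" if ac: "0 < a" "a \<le> c" for a c
  proof (rule ccontr)
    assume "\<not> ?thesis"
    then have gap: "K < integral {a..c} p" by simp
    define \<delta> where "\<delta> = b / D * (integral {a..c} p - K)"
    have \<delta>: "0 < \<delta>" using gap b D by (simp add: \<delta>_def)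
    have "eventually (\<lambda>n. s n < a) sequentially"
      by (rule order_tendstoD(2)[OF s(2) ac(1)])
    moreover have "eventually (\<lambda>n. c < R n) sequentially"
      using R by (simp add: filterlim_at_top_dense)
    ultimately have "eventually (\<lambda>n. ereal (W (R n) - W (s n)) \<le> ereal (- \<delta>)) sequentially"
    proof eventually_elim
      case (elim n)
      have sub: "p integrable_on {x..y}" if "0 < x" for x y
        by (intro integrable_continuous_real continuous_on_subset[OF cp]) (use that in auto)
      have "integral {a..c} p \<le> integral {s n..R n} p"
        using elim ac s(1)[of n] p0 by (intro integral_subset_le sub) auto
      then have "b / D * (K - integral {s n..R n} p) \<le> b / D * (K - integral {a..c} p)"
        using b D by (intro mult_left_mono) auto
      also have "\<dots> = - \<delta>" by (simp add: \<delta>_def algebra_simps)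
      finally show ?case
        using step[of "s n" "R n"] s(1)[of n] elim ac by simp
    qed
    then have "l \<le> ereal (- \<delta>)"
      using l(1) by (intro tendsto_upperbound[where F = sequentially]) (auto simp: W_def)
    with l(2) have "(0 :: ereal) \<le> ereal (- \<delta>)" by (rule order_trans)
    with \<delta> show False by simp
  qed
  have "(\<integral>\<^sup>+ r. ennreal (p r) \<partial>lebesgue_on {0<..}) \<le> ennreal K"
    by (rule nn_integral_half_line_le[OF cp p0 bound])
  also note qK[symmetric]
  finally show ?thesis unfolding p_def q_def .
qed simp

end

section \<open>The Hardy inequality\<close>

lemma C1_differentiable_on_deriv:
  assumes "f C1_differentiable_on S" "x \<in> S"
  shows "(f has_real_derivative deriv f x) (at x)"
proof -
  obtain f' where "(f has_vector_derivative f' x) (at x)"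
    using assms unfolding C1_differentiable_on_def by blast
  then have "(f has_real_derivative f' x) (at x)"
    by (simp add: has_real_derivative_iff_has_vector_derivative)
  then show ?thesis using DERIV_imp_deriv by metis
qed

context power_type_N_function
begin

lemma c_fun_mono:
  assumes "0 \<le> x" "x \<le> y"
  shows "c_fun d D x \<le> c_fun d D y"
proof -
  have "x powr d \<le> y powr d" "x powr D \<le> y powr D"
    using assms d_ge_1 D_ge_1 by (auto intro!: powr_mono2)
  then show ?thesis by (auto simp: c_fun_def)
qed

text \<open>
  With \<open>\<rho> = \<omega>' / (\<omega> * \<phi>')\<close> and \<open>Y = \<omega> r * y\<close>, both bounds come from estimating \<open>\<rho> * (Y * even_deriv Y)\<close> by
  \<open>d * M \<bar>Y\<bar> \<le> Y * even_deriv Y \<le> D * M \<bar>Y\<bar>\<close>. Which of the two bounds is used depends on the sign of \<open>\<rho>\<close>, and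
  the sets \<open>set_F\<close> and \<open>set_G\<close> are exactly where \<open>\<rho>\<close> is positive and negative.
\<close>

lemma log_derivative_bounds:
  fixes \<phi> \<omega> :: "real \<Rightarrow> real"
  assumes r: "0 < r" and \<phi>': "deriv \<phi> r \<noteq> 0" and \<omega>: "0 \<le> \<omega> r"
  shows "deriv \<omega> r * y / deriv \<phi> r * even_deriv (\<omega> r * y)
    \<le> (1 + deriv (deriv \<phi>) r / (deriv \<phi> r)\<^sup>2 - b1_at r \<omega> \<phi> d D) * M \<bar>\<omega> r * y\<bar>"
    and "(- 1 - deriv (deriv \<phi>) r / (deriv \<phi> r)\<^sup>2 - b2_at r \<omega> \<phi> d D) * M \<bar>\<omega> r * y\<bar> \<ge>
      - (deriv \<omega> r * y / deriv \<phi> r * even_deriv (\<omega> r * y))"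
proof -
  define \<rho> where "\<rho> = deriv \<omega> r / (\<omega> r * deriv \<phi> r)"
  define Y where "Y = \<omega> r * y"
  note bds = even_deriv_bounds[of Y]
  define \<chi>F where "\<chi>F = (indicator (set_F \<omega> \<phi>) r :: real)"
  define \<chi>G where "\<chi>G = (indicator (set_G \<omega> \<phi>) r :: real)"
  consider (zero) "\<omega> r = 0" | (F) "0 < \<omega> r" "0 < deriv \<omega> r * deriv \<phi> r"
    | (G) "0 < \<omega> r" "deriv \<omega> r * deriv \<phi> r < 0" | (crit) "0 < \<omega> r" "deriv \<omega> r = 0"
    using \<omega> \<phi>' by (metis less_eq_real_def linorder_neqE_linordered_idom mult_eq_0_iff)
  then have "deriv \<omega> r * y / deriv \<phi> r * even_deriv Y \<le> \<rho> * (d * \<chi>G + D * \<chi>F) * M \<bar>Y\<bar>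
    \<and> \<rho> * (d * \<chi>F + D * \<chi>G) * M \<bar>Y\<bar> \<le> deriv \<omega> r * y / deriv \<phi> r * even_deriv Y"
  proof cases
    case zero
    then show ?thesis by (simp add: Y_def even_deriv_def at_zero)
  next
    case F
    have "0 < \<rho>" using F by (auto simp: \<rho>_def zero_less_divide_iff zero_less_mult_iff mult_less_0_iff)
    moreover have "\<chi>F = 1" "\<chi>G = 0"
      using F r by (auto simp: \<chi>F_def \<chi>G_def set_F_def set_G_def)
    moreover have "deriv \<omega> r * y / deriv \<phi> r * even_deriv Y = \<rho> * (Y * even_deriv Y)"
      using F \<phi>' by (simp add: \<rho>_def Y_def)
    ultimately show ?thesis
      using bds by (simp add: mult.assoc)
  next
    case G
    have "\<rho> < 0" using G by (auto simp: \<rho>_def divide_less_0_iff mult_less_0_iff zero_less_mult_iff)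
    moreover have "\<chi>F = 0" "\<chi>G = 1"
      using G r by (auto simp: \<chi>F_def \<chi>G_def set_F_def set_G_def)
    moreover have "deriv \<omega> r * y / deriv \<phi> r * even_deriv Y = \<rho> * (Y * even_deriv Y)"
      using G \<phi>' by (simp add: \<rho>_def Y_def)
    ultimately show ?thesis
      using bds by (simp add: mult.assoc)
  next
    case crit
    then show ?thesis by (simp add: \<rho>_def)
  qed
  then show "deriv \<omega> r * y / deriv \<phi> r * even_deriv (\<omega> r * y)
    \<le> (1 + deriv (deriv \<phi>) r / (deriv \<phi> r)\<^sup>2 - b1_at r \<omega> \<phi> d D) * M \<bar>\<omega> r * y\<bar>"
    "(- 1 - deriv (deriv \<phi>) r / (deriv \<phi> r)\<^sup>2 - b2_at r \<omega> \<phi> d D) * M \<bar>\<omega> r * y\<bar> \<ge>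
      - (deriv \<omega> r * y / deriv \<phi> r * even_deriv (\<omega> r * y))"
    by (simp_all add: b1_at_def b2_at_def \<rho>_def Y_def \<chi>F_def \<chi>G_def)
qed

text \<open>
  Both parts of the theorem at once: the sign \<open>\<sigma>\<close> is \<open>1\<close> for the first and \<open>-1\<close> for the second, and
  multiplies the boundary term \<open>h * exp (- \<phi>)\<close>. The energy argument gives the constant
  \<open>c (L * D / b)\<close>, which is at most \<open>c (L * D\<^sup>2 / (b * d))\<close> because \<open>D / d \<ge> 1\<close> and \<open>c\<close> is monotone.
\<close>

lemma mu_inequality:
  fixes \<phi> \<omega> u v :: "real \<Rightarrow> real" and s R :: "nat \<Rightarrow> real" and \<sigma> L b :: real
  assumes b: "0 < b" and L: "0 \<le> L" and \<sigma>: "\<bar>\<sigma>\<bar> = 1"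
    and \<phi>: "\<phi> C1_differentiable_on {0<..}" "deriv \<phi> C1_differentiable_on {0<..}"
      "\<And>r. 0 < r \<Longrightarrow> deriv \<phi> r \<noteq> 0"
    and \<omega>: "\<omega> C1_differentiable_on {0<..}" "\<And>r. 0 < r \<Longrightarrow> 0 \<le> \<omega> r"
    and bound: "\<And>r. 0 < r \<Longrightarrow> \<omega> r / \<bar>deriv \<phi> r\<bar> \<le> L"
    and decay: "\<And>r y. 0 < r \<Longrightarrow> \<sigma> * (deriv \<omega> r * y / deriv \<phi> r * even_deriv (\<omega> r * y))
      \<le> (\<sigma> * (1 + deriv (deriv \<phi>) r / (deriv \<phi> r)\<^sup>2) - b) * M \<bar>\<omega> r * y\<bar>"
    and u: "u \<in> W11_loc" and v: "weak_derivative u v"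
    and s: "\<And>n. 0 < s n" "s \<longlonglongrightarrow> 0" and R: "\<And>n. 0 < R n" "filterlim R at_top sequentially"
    and l: "(\<lambda>n. ereal (\<sigma> * (h_fun \<omega> \<phi> M u (R n) * exp (- \<phi> (R n))
                    - h_fun \<omega> \<phi> M u (s n) * exp (- \<phi> (s n))))) \<longlonglongrightarrow> l" "0 \<le> l"
  shows "(\<integral>\<^sup>+ r. ennreal (M (\<omega> r * \<bar>u r\<bar>)) \<partial>mu \<phi>)
    \<le> ennreal (c_fun d D (L * D\<^sup>2 / (b * d))) * (\<integral>\<^sup>+ r. ennreal (M \<bar>v r\<bar>) \<partial>mu \<phi>)"
proof -
  define w where "w r = exp (- \<phi> r)" for r
  define A where "A r = \<sigma> * (w r / deriv \<phi> r)" for r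
  define A' where "A' r = - (\<sigma> * (w r * (1 + deriv (deriv \<phi>) r / (deriv \<phi> r)\<^sup>2)))" for r
  have D: "0 < D" using D_ge_1 by simp
  have d\<phi>: "(\<phi> has_real_derivative deriv \<phi> r) (at r)"
    and d\<phi>': "(deriv \<phi> has_real_derivative deriv (deriv \<phi>) r) (at r)"
    and d\<omega>: "(\<omega> has_real_derivative deriv \<omega> r) (at r)" if "0 < r" for r
    using that by (auto intro: C1_differentiable_on_deriv \<phi> \<omega>)
  have wpos: "0 < w r" for r by (simp add: w_def)
  have w: "(w has_real_derivative - (deriv \<phi> r * w r)) (at r)" if "0 < r" for r
    unfolding w_def[abs_def] using d\<phi>[OF that] by (auto intro!: derivative_eq_intros)
  have wc: "continuous_on {0<..} w"
    by (rule DERIV_continuous_on[OF has_field_derivative_at_within[OF w]]) simp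
  have dA: "(A has_real_derivative A' r) (at r)" if r: "0 < r" for r
    unfolding A_def[abs_def] A'_def
    by (rule DERIV_cong[OF DERIV_cmult[OF DERIV_divide[OF w[OF r] d\<phi>'[OF r] \<phi>(3)[OF r]]]])
      (use \<phi>(3)[OF r] in \<open>simp add: field_simps power2_eq_square\<close>)
  have uc: "continuous_on {0<..} u"
    using u by (intro locally_abs_continuous_imp_continuous_on) (simp add: W11_loc_def)
  have h: "\<sigma> * (h_fun \<omega> \<phi> M u r * exp (- \<phi> r)) = A r * M \<bar>\<omega> r * u r\<bar>" if "0 < r" for r
    using \<omega>(2)[OF that] by (simp add: h_fun_def A_def w_def abs_mult)
  have core: "(\<integral>\<^sup>+ r. ennreal (w r * M \<bar>\<omega> r * u r\<bar>) \<partial>lebesgue_on {0<..})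
    \<le> (\<integral>\<^sup>+ r. ennreal (w r * M (L * D / b * \<bar>v r\<bar>)) \<partial>lebesgue_on {0<..})"
  proof (rule weighted_inequality[OF b L dA d\<omega> wc wpos _ _ uc v s R(2) _ l(2)])
    fix r y :: real assume r: "0 < r"
    have "w r * (\<sigma> * (deriv \<omega> r * y / deriv \<phi> r * even_deriv (\<omega> r * y)))
      \<le> w r * ((\<sigma> * (1 + deriv (deriv \<phi>) r / (deriv \<phi> r)\<^sup>2) - b) * M \<bar>\<omega> r * y\<bar>)"
      using decay[OF r] wpos[of r] by (intro mult_left_mono) auto
    then show "A' r * M \<bar>\<omega> r * y\<bar> + A r * even_deriv (\<omega> r * y) * deriv \<omega> r * y \<le> - b * (w r * M \<bar>\<omega> r * y\<bar>)"
      by (simp add: A_def A'_def algebra_simps)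
    have "\<bar>A r * \<omega> r\<bar> = w r * (\<omega> r / \<bar>deriv \<phi> r\<bar>)"
      using \<sigma> wpos[of r] \<omega>(2)[OF r] by (simp add: A_def abs_mult)
    also have "\<dots> \<le> w r * L"
      using wpos[of r] by (intro mult_left_mono bound r) simp
    finally show "\<bar>A r * \<omega> r\<bar> \<le> L * w r" by (simp add: mult.commute)
  next
    show "(\<lambda>n. ereal (A (R n) * M \<bar>\<omega> (R n) * u (R n)\<bar> - A (s n) * M \<bar>\<omega> (s n) * u (s n)\<bar>)) \<longlonglongrightarrow> l"
      using l(1) by (simp add: right_diff_distrib h s(1) R(1))
  qed
  have vm: "v \<in> borel_measurable (lebesgue_on {0<..})"
    using v by (intro locally_integrable_imp_measurable) (simp add: weak_derivative_def)
  have Mm: "(\<lambda>y. M \<bar>y\<bar>) \<in> borel_measurable borel"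
    by (intro borel_measurable_continuous_onI DERIV_continuous_on[OF has_field_derivative_at_within[OF even_has_derivative]])
  have Mm': "(\<lambda>r. M \<bar>g r\<bar>) \<in> borel_measurable (lebesgue_on {0<..})"
    if "g \<in> borel_measurable (lebesgue_on {0<..})" for g
    by (rule measurable_compose[OF that Mm])
  have wm: "w \<in> borel_measurable (lebesgue_on {0<..})"
    by (intro continuous_imp_measurable_on_sets_lebesgue wc) simp
  have density: "(\<integral>\<^sup>+ r. ennreal (M \<bar>g r\<bar>) \<partial>mu \<phi>) = (\<integral>\<^sup>+ r. ennreal (w r * M \<bar>g r\<bar>) \<partial>lebesgue_on {0<..})"
    if "g \<in> borel_measurable (lebesgue_on {0<..})" for g
  proof -
    have "(\<integral>\<^sup>+ r. ennreal (M \<bar>g r\<bar>) \<partial>mu \<phi>) = (\<integral>\<^sup>+ r. ennreal (w r) * ennreal (M \<bar>g r\<bar>) \<partial>lebesgue_on {0<..})"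
      unfolding mu_def w_def[symmetric]
      using wm Mm'[OF that] by (intro nn_integral_density measurable_compose[OF _ measurable_ennreal])
    then show ?thesis
      using wpos by (simp add: ennreal_mult less_imp_le nonneg)
  qed
  have um: "(\<lambda>r. \<omega> r * u r) \<in> borel_measurable (lebesgue_on {0<..})"
    by (intro continuous_imp_measurable_on_sets_lebesgue continuous_on_mult uc
        DERIV_continuous_on[OF has_field_derivative_at_within[OF d\<omega>]]) auto
  have k: "0 \<le> L * D / b" using L D b by simp
  have kle: "L * D / b \<le> L * D\<^sup>2 / (b * d)"
  proof -
    have "L * D / b * 1 \<le> L * D / b * (D / d)"
      using k d_ge_1 d_le_D by (intro mult_left_mono) auto
    then show ?thesis by (simp add: power2_eq_square mult_ac)
  qed
  have "(\<integral>\<^sup>+ r. ennreal (M (\<omega> r * \<bar>u r\<bar>)) \<partial>mu \<phi>) = (\<integral>\<^sup>+ r. ennreal (M \<bar>\<omega> r * u r\<bar>) \<partial>mu \<phi>)"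
    using \<omega>(2) by (intro nn_integral_cong) (auto simp: mu_def space_restrict_space abs_mult)
  also have "\<dots> \<le> (\<integral>\<^sup>+ r. ennreal (w r * M (L * D / b * \<bar>v r\<bar>)) \<partial>lebesgue_on {0<..})"
    unfolding density[OF um] by (rule core)
  also have "\<dots> \<le> (\<integral>\<^sup>+ r. ennreal (c_fun d D (L * D\<^sup>2 / (b * d))) * ennreal (w r * M \<bar>v r\<bar>) \<partial>lebesgue_on {0<..})"
  proof (rule nn_integral_mono)
    fix r
    have "M (L * D / b * \<bar>v r\<bar>) \<le> c_fun d D (L * D / b) * M \<bar>v r\<bar>"
      using k by (intro scaling) auto
    also have "\<dots> \<le> c_fun d D (L * D\<^sup>2 / (b * d)) * M \<bar>v r\<bar>"
      by (intro mult_right_mono c_fun_mono k kle nonneg) simp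
    finally have "w r * M (L * D / b * \<bar>v r\<bar>) \<le> w r * (c_fun d D (L * D\<^sup>2 / (b * d)) * M \<bar>v r\<bar>)"
      using wpos[of r] by (intro mult_left_mono) auto
    also have "\<dots> = c_fun d D (L * D\<^sup>2 / (b * d)) * (w r * M \<bar>v r\<bar>)" by simp
    finally show "ennreal (w r * M (L * D / b * \<bar>v r\<bar>))
        \<le> ennreal (c_fun d D (L * D\<^sup>2 / (b * d))) * ennreal (w r * M \<bar>v r\<bar>)"
      using wpos[of r] by (subst ennreal_mult[symmetric]) (auto simp: c_fun_def nonneg ennreal_leI le_max_iff_disj)
  qed
  also have "\<dots> = ennreal (c_fun d D (L * D\<^sup>2 / (b * d))) * (\<integral>\<^sup>+ r. ennreal (w r * M \<bar>v r\<bar>) \<partial>lebesgue_on {0<..})"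
    using wm Mm'[OF vm] by (intro nn_integral_cmult) simp
  also have "(\<integral>\<^sup>+ r. ennreal (w r * M \<bar>v r\<bar>) \<partial>lebesgue_on {0<..}) = (\<integral>\<^sup>+ r. ennreal (M \<bar>v r\<bar>) \<partial>mu \<phi>)"
    by (rule density[OF vm, symmetric])
  finally show ?thesis .
qed

end

text \<open>
  Positivity makes the infimum a genuine positive real: a single value of \<open>f\<close> bounds it from above.
  Hence \<open>real_of_ereal\<close> loses nothing in the constants.
\<close>

lemma INF_ereal_pos_real:
  fixes f :: "'a \<Rightarrow> real"
  assumes "(INF r\<in>S. ereal (f r)) > 0" "S \<noteq> {}"
  obtains b where "(INF r\<in>S. ereal (f r)) = ereal b" "0 < b" "\<And>r. r \<in> S \<Longrightarrow> b \<le> f r"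
proof -
  let ?I = "INF r\<in>S. ereal (f r)"
  have le: "?I \<le> ereal (f r)" if "r \<in> S" for r using that by (rule INF_lower)
  obtain r where "r \<in> S" using assms(2) by blast
  then have "?I \<noteq> \<infinity>" "?I \<noteq> - \<infinity>" using le[of r] assms(1) by auto
  then obtain b where b: "?I = ereal b" by (cases ?I) auto
  show thesis
  proof (rule that[OF b])
    show "0 < b" using assms(1) b by simp
    show "b \<le> f r" if "r \<in> S" for r using le[OF that] b by simp
  qed
qed

theorem theorem2p1:
  fixes M \<phi> \<omega> :: "real \<Rightarrow> real" and d D :: real
  assumes "N_function M" and "M differentiable_on {0..}"
    and "1 \<le> d" and "d \<le> D"
    and "\<And>x. 0 < x \<Longrightarrow> d * (M x / x) \<le> deriv M x \<and> deriv M x \<le> D * (M x / x)"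
    and "\<phi> C1_differentiable_on {0<..}" and "deriv \<phi> C1_differentiable_on {0<..}"
    and "\<And>r. 0 < r \<Longrightarrow> deriv \<phi> r \<noteq> 0"
    and "\<omega> C1_differentiable_on {0<..}" and "\<And>r. 0 < r \<Longrightarrow> 0 \<le> \<omega> r"
    and "L_const \<omega> \<phi> < \<infinity>"
  shows "(b1 \<omega> \<phi> d D > 0 \<longrightarrow>
           (\<forall>u \<in> R_plus \<omega> \<phi> M. \<forall>u'. weak_derivative u u' \<longrightarrow>
              (\<integral>\<^sup>+ r. ennreal (M (\<omega> r * \<bar>u r\<bar>)) \<partial>mu \<phi>)
                \<le> ennreal (c_fun d D (real_of_ereal (L_const \<omega> \<phi>) * D\<^sup>2
                                        / (real_of_ereal (b1 \<omega> \<phi> d D) * d)))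
                   * (\<integral>\<^sup>+ r. ennreal (M \<bar>u' r\<bar>) \<partial>mu \<phi>)))
       \<and> (b2 \<omega> \<phi> d D > 0 \<longrightarrow>
           (\<forall>u \<in> R_minus \<omega> \<phi> M. \<forall>u'. weak_derivative u u' \<longrightarrow>
              (\<integral>\<^sup>+ r. ennreal (M (\<omega> r * \<bar>u r\<bar>)) \<partial>mu \<phi>)
                \<le> ennreal (c_fun d D (real_of_ereal (L_const \<omega> \<phi>) * D\<^sup>2
                                        / (real_of_ereal (b2 \<omega> \<phi> d D) * d)))
                   * (\<integral>\<^sup>+ r. ennreal (M \<bar>u' r\<bar>) \<partial>mu \<phi>)))"
proof -
  interpret power_type_N_function M d D
    by unfold_locales (fact assms)+
  have Lr: "ereal (\<omega> r / \<bar>deriv \<phi> r\<bar>) \<le> L_const \<omega> \<phi>" if "0 < r" for r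
    unfolding L_const_def using that by (intro SUP_upper) simp
  obtain L where L: "L_const \<omega> \<phi> = ereal L"
    using Lr[of 1] assms(11) by (cases "L_const \<omega> \<phi>") auto
  have bound: "\<omega> r / \<bar>deriv \<phi> r\<bar> \<le> L" if "0 < r" for r
    using Lr[OF that] L by simp
  have "0 \<le> \<omega> 1 / \<bar>deriv \<phi> 1\<bar>" using assms(10)[of 1] by simp
  also have "\<dots> \<le> L" by (rule bound) simp
  finally have L0: "0 \<le> L" .
  show ?thesis
  proof (intro conjI impI ballI allI)
    fix u u' assume pos: "b1 \<omega> \<phi> d D > 0" and u: "u \<in> R_plus \<omega> \<phi> M" and v: "weak_derivative u u'"
    obtain b where b: "b1 \<omega> \<phi> d D = ereal b" "0 < b" "\<And>r. 0 < r \<Longrightarrow> b \<le> b1_at r \<omega> \<phi> d D"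
      using INF_ereal_pos_real[OF pos[unfolded b1_def] greaterThan_non_empty]
      unfolding b1_def greaterThan_iff by metis
    obtain s R l where sR: "\<And>n. 0 < s n" "s \<longlonglongrightarrow> 0" "\<And>n. 0 < R n" "filterlim R at_top sequentially"
      "(\<lambda>n. ereal (h_fun \<omega> \<phi> M u (R n) * exp (- \<phi> (R n))
                    - h_fun \<omega> \<phi> M u (s n) * exp (- \<phi> (s n)))) \<longlonglongrightarrow> l" "0 \<le> l" and uW: "u \<in> W11_loc"
      using u unfolding R_plus_def by blast
    have "(\<integral>\<^sup>+ r. ennreal (M (\<omega> r * \<bar>u r\<bar>)) \<partial>mu \<phi>)
        \<le> ennreal (c_fun d D (L * D\<^sup>2 / (b * d))) * (\<integral>\<^sup>+ r. ennreal (M \<bar>u' r\<bar>) \<partial>mu \<phi>)"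
    proof (rule mu_inequality[OF b(2) L0 _ assms(6-10) bound _ uW v sR(1-4) _ sR(6), where \<sigma> = 1])
      fix r y :: real assume r: "0 < r"
      have "b * M \<bar>\<omega> r * y\<bar> \<le> b1_at r \<omega> \<phi> d D * M \<bar>\<omega> r * y\<bar>"
        using b(3)[OF r] by (intro mult_right_mono nonneg) auto
      then show "1 * (deriv \<omega> r * y / deriv \<phi> r * even_deriv (\<omega> r * y))
          \<le> (1 * (1 + deriv (deriv \<phi>) r / (deriv \<phi> r)\<^sup>2) - b) * M \<bar>\<omega> r * y\<bar>"
        using log_derivative_bounds(1)[of r \<phi> \<omega> y, OF r assms(8,10)[OF r]] by (simp add: left_diff_distrib)
    qed (use sR(5) in simp_all)
    then show "(\<integral>\<^sup>+ r. ennreal (M (\<omega> r * \<bar>u r\<bar>)) \<partial>mu \<phi>)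
                \<le> ennreal (c_fun d D (real_of_ereal (L_const \<omega> \<phi>) * D\<^sup>2
                                        / (real_of_ereal (b1 \<omega> \<phi> d D) * d)))
                   * (\<integral>\<^sup>+ r. ennreal (M \<bar>u' r\<bar>) \<partial>mu \<phi>)"
      by (simp add: L b(1))
  next
    fix u u' assume pos: "b2 \<omega> \<phi> d D > 0" and u: "u \<in> R_minus \<omega> \<phi> M" and v: "weak_derivative u u'"
    obtain b where b: "b2 \<omega> \<phi> d D = ereal b" "0 < b" "\<And>r. 0 < r \<Longrightarrow> b \<le> b2_at r \<omega> \<phi> d D"
      using INF_ereal_pos_real[OF pos[unfolded b2_def] greaterThan_non_empty]
      unfolding b2_def greaterThan_iff by metis
    obtain s R l where sR: "\<And>n. 0 < s n" "s \<longlonglongrightarrow> 0" "\<And>n. 0 < R n" "filterlim R at_top sequentially"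
      "(\<lambda>n. ereal (h_fun \<omega> \<phi> M u (R n) * exp (- \<phi> (R n))
                    - h_fun \<omega> \<phi> M u (s n) * exp (- \<phi> (s n)))) \<longlonglongrightarrow> l" "l \<le> 0" and uW: "u \<in> W11_loc"
      using u unfolding R_minus_def by blast
    have l0: "0 \<le> - l" using sR(6) by (simp add: ereal_uminus_le_reorder)
    have "(\<integral>\<^sup>+ r. ennreal (M (\<omega> r * \<bar>u r\<bar>)) \<partial>mu \<phi>)
        \<le> ennreal (c_fun d D (L * D\<^sup>2 / (b * d))) * (\<integral>\<^sup>+ r. ennreal (M \<bar>u' r\<bar>) \<partial>mu \<phi>)"
    proof (rule mu_inequality[OF b(2) L0 _ assms(6-10) bound _ uW v sR(1-4) _ l0, where \<sigma> = "-1"])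
      fix r y :: real assume r: "0 < r"
      have "b * M \<bar>\<omega> r * y\<bar> \<le> b2_at r \<omega> \<phi> d D * M \<bar>\<omega> r * y\<bar>"
        using b(3)[OF r] by (intro mult_right_mono nonneg) auto
      then show "-1 * (deriv \<omega> r * y / deriv \<phi> r * even_deriv (\<omega> r * y))
          \<le> (-1 * (1 + deriv (deriv \<phi>) r / (deriv \<phi> r)\<^sup>2) - b) * M \<bar>\<omega> r * y\<bar>"
        using log_derivative_bounds(2)[of r \<phi> \<omega> y, OF r assms(8,10)[OF r]] by (simp add: left_diff_distrib)
    next
      from tendsto_uminus_ereal[OF sR(5)]
      show "(\<lambda>n. ereal (-1 * (h_fun \<omega> \<phi> M u (R n) * exp (- \<phi> (R n))
                    - h_fun \<omega> \<phi> M u (s n) * exp (- \<phi> (s n))))) \<longlonglongrightarrow> - l" by simp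
    qed simp
    then show "(\<integral>\<^sup>+ r. ennreal (M (\<omega> r * \<bar>u r\<bar>)) \<partial>mu \<phi>)
                \<le> ennreal (c_fun d D (real_of_ereal (L_const \<omega> \<phi>) * D\<^sup>2
                                        / (real_of_ereal (b2 \<omega> \<phi> d D) * d)))
                   * (\<integral>\<^sup>+ r. ennreal (M \<bar>u' r\<bar>) \<partial>mu \<phi>)"
      by (simp add: L b(1))
  qed
qed

end
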